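(* Let $G$ be a prosoluble group in which for every subset $\pi\subseteq\pi(G)$ there is a Hall $\pi$-subgroup $H_\pi$ of $G$ and a Hall $\pi'$-subgroup $H_{\pi'}$ of $G$ such that $\mathrm{Pr}(H_\pi,H_{\pi'})>0$. Then $G$ is virtually pronilpotent, i.e. $G$ has an open pronilpotent subgroup.
   Context: For closed subgroups $H,K$ of a compact Hausdorff topological group $G$, let $\mu_H,\mu_K$ be the normalized Haar measures of $H$ and $K$ (so $\mu_H(H)=\mu_K(K)=1$). The commuting probability is $\mathrm{Pr}(H,K)=(\mu_H\times\mu_K)(\{(x,y)\in H\times K \mid xy=yx\})$. For a profinite group $G$, $\pi(G)$ denotes the set of primes dividing the order of $G$ (a supernatural number). For a set of primes $\pi$, $\pi'$ denotes the complementary set of primes, and a Hall $\pi$-subgroup of $G$ is a closed subgroup whose order involves only primes in $\pi$ and whose index (as a supernatural number) is divisible by no prime in $\pi$. Prosoluble (pronilpotent) groups are inverse limits of finite soluble (nilpotent) groups. A profinite group virtually has a property if it has an open subgroup with that property. *)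

theory Defs
  imports
    "HOL-Analysis.Analysis"
    "HOL-Probability.Probability_Measure"
    "HOL-Algebra.Solvable_Groups"
    "HOL-Algebra.Product_Groups"
begin

section \<open>Topological groups\<close>

text \<open>A topological group is a HOL-Algebra group \<open>G\<close> with an abstract topology \<open>T\<close> on its
  carrier.  A subgroup \<open>H\<close> is viewed as the topological group
  \<open>G\<lparr>carrier := H\<rparr>\<close> with topology \<open>subtopology T H\<close>.\<close>

definition topological_group :: "('a, 'm) monoid_scheme \<Rightarrow> 'a topology \<Rightarrow> bool" where
  "topological_group G T \<longleftrightarrow>
     group G \<and> topspace T = carrier G \<and>
     continuous_map (prod_topology T T) T (\<lambda>(x, y). x \<otimes>\<^bsub>G\<^esub> y) \<and>
     continuous_map T T (\<lambda>x. inv\<^bsub>G\<^esub> x)"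

section \<open>Inverse limits\<close>

definition inverse_system ::
  "'i set \<Rightarrow> 'i rel \<Rightarrow> ('i \<Rightarrow> ('c, 'm) monoid_scheme) \<Rightarrow> ('i \<Rightarrow> 'i \<Rightarrow> 'c \<Rightarrow> 'c) \<Rightarrow> bool" where
  "inverse_system I r F \<phi> \<longleftrightarrow>
     I \<noteq> {} \<and> partial_order_on I r \<and>
     (\<forall>i\<in>I. \<forall>j\<in>I. \<exists>k\<in>I. (i, k) \<in> r \<and> (j, k) \<in> r) \<and>
     (\<forall>i\<in>I. group (F i)) \<and>
     (\<forall>i\<in>I. \<forall>j\<in>I. (i, j) \<in> r \<longrightarrow> \<phi> i j \<in> hom (F j) (F i)) \<and>
     (\<forall>i\<in>I. \<forall>x\<in>carrier (F i). \<phi> i i x = x) \<and>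
     (\<forall>i\<in>I. \<forall>j\<in>I. \<forall>k\<in>I. (i, j) \<in> r \<and> (j, k) \<in> r \<longrightarrow>
        (\<forall>x\<in>carrier (F k). \<phi> i j (\<phi> j k x) = \<phi> i k x))"

definition inverse_limit_set ::
  "'i set \<Rightarrow> 'i rel \<Rightarrow> ('i \<Rightarrow> ('c, 'm) monoid_scheme) \<Rightarrow> ('i \<Rightarrow> 'i \<Rightarrow> 'c \<Rightarrow> 'c) \<Rightarrow> ('i \<Rightarrow> 'c) set" where
  "inverse_limit_set I r F \<phi> =
     {x \<in> (\<Pi>\<^sub>E i\<in>I. carrier (F i)). \<forall>i\<in>I. \<forall>j\<in>I. (i, j) \<in> r \<longrightarrow> \<phi> i j (x j) = x i}"

definition inverse_limit_group ::
  "'i set \<Rightarrow> 'i rel \<Rightarrow> ('i \<Rightarrow> ('c, 'm) monoid_scheme) \<Rightarrow> ('i \<Rightarrow> 'i \<Rightarrow> 'c \<Rightarrow> 'c) \<Rightarrow> ('i \<Rightarrow> 'c) monoid" where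
  "inverse_limit_group I r F \<phi> = (product_group I F)\<lparr>carrier := inverse_limit_set I r F \<phi>\<rparr>"

definition inverse_limit_topology ::
  "'i set \<Rightarrow> 'i rel \<Rightarrow> ('i \<Rightarrow> ('c, 'm) monoid_scheme) \<Rightarrow> ('i \<Rightarrow> 'i \<Rightarrow> 'c \<Rightarrow> 'c) \<Rightarrow> ('i \<Rightarrow> 'c) topology" where
  "inverse_limit_topology I r F \<phi> =
     subtopology (product_topology (\<lambda>i. discrete_topology (carrier (F i))) I)
       (inverse_limit_set I r F \<phi>)"

text \<open>\<open>G\<close> is topologically isomorphic to the inverse limit of an inverse system of finite groups
  satisfying \<open>P\<close>.  HOL cannot quantify over the types of the index set and of the finite groups;
  both are taken to be \<open>'a set\<close>.  For a \<open>P\<close> that is invariant under isomorphism and inherited by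
  subgroups and quotients this loses no generality: such a \<open>G\<close> is then the inverse limit of its
  quotients \<open>G Mod N\<close>, indexed by its open normal subgroups \<open>N\<close>.\<close>

definition inverse_limit_of_finite ::
  "('a set monoid \<Rightarrow> bool) \<Rightarrow> ('a, 'm) monoid_scheme \<Rightarrow> 'a topology \<Rightarrow> bool" where
  "inverse_limit_of_finite P G T \<longleftrightarrow>
     topological_group G T \<and>
     (\<exists>(I :: 'a set set) r (F :: 'a set \<Rightarrow> 'a set monoid) \<phi> h.
        inverse_system I r F \<phi> \<and>
        (\<forall>i\<in>I. finite (carrier (F i)) \<and> P (F i)) \<and>
        h \<in> iso G (inverse_limit_group I r F \<phi>) \<and>
        homeomorphic_map T (inverse_limit_topology I r F \<phi>) h)"

fun lower_central_series :: "('a, 'm) monoid_scheme \<Rightarrow> nat \<Rightarrow> 'a set" where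
  "lower_central_series G 0 = carrier G"
| "lower_central_series G (Suc n) =
     generate G (\<Union>h\<in>lower_central_series G n. \<Union>g\<in>carrier G.
       {h \<otimes>\<^bsub>G\<^esub> g \<otimes>\<^bsub>G\<^esub> inv\<^bsub>G\<^esub> h \<otimes>\<^bsub>G\<^esub> inv\<^bsub>G\<^esub> g})"

definition nilpotent :: "('a, 'm) monoid_scheme \<Rightarrow> bool" where
  "nilpotent G \<longleftrightarrow> (\<exists>n. lower_central_series G n = {\<one>\<^bsub>G\<^esub>})"

definition prosoluble :: "('a, 'm) monoid_scheme \<Rightarrow> 'a topology \<Rightarrow> bool" where
  "prosoluble G T \<longleftrightarrow> inverse_limit_of_finite solvable G T"

definition pronilpotent :: "('a, 'm) monoid_scheme \<Rightarrow> 'a topology \<Rightarrow> bool" where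
  "pronilpotent G T \<longleftrightarrow> inverse_limit_of_finite nilpotent G T"

definition virtually ::
  "(('a, 'm) monoid_scheme \<Rightarrow> 'a topology \<Rightarrow> bool) \<Rightarrow> ('a, 'm) monoid_scheme \<Rightarrow> 'a topology \<Rightarrow> bool" where
  "virtually P G T \<longleftrightarrow>
     (\<exists>H. subgroup H G \<and> openin T H \<and> P (G\<lparr>carrier := H\<rparr>) (subtopology T H))"

section \<open>Supernatural orders and Hall subgroups\<close>

text \<open>A supernatural number is given by its exponents at the primes; values at non-primes are
  meaningless.\<close>

type_synonym supernatural = "nat \<Rightarrow> enat"

definition divides_supernatural :: "nat \<Rightarrow> supernatural \<Rightarrow> bool" where
  "divides_supernatural p n \<longleftrightarrow> prime p \<and> n p > 0"

text \<open>The index of a closed subgroup \<open>H\<close> of a profinite group \<open>G\<close> is the least common multiple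
  of the (finite) indices of the subgroups \<open>H N\<close>, for \<open>N\<close> open and normal in \<open>G\<close>.\<close>

definition profinite_index :: "('a, 'm) monoid_scheme \<Rightarrow> 'a topology \<Rightarrow> 'a set \<Rightarrow> supernatural" where
  "profinite_index G T H =
     (\<lambda>p. SUP N\<in>{N. N \<lhd> G \<and> openin T N}.
        enat (multiplicity p (card (rcosets\<^bsub>G\<^esub> (H <#>\<^bsub>G\<^esub> N)))))"

definition profinite_order :: "('a, 'm) monoid_scheme \<Rightarrow> 'a topology \<Rightarrow> supernatural" where
  "profinite_order G T = profinite_index G T {\<one>\<^bsub>G\<^esub>}"

definition prime_divisors_of_order :: "('a, 'm) monoid_scheme \<Rightarrow> 'a topology \<Rightarrow> nat set" where
  "prime_divisors_of_order G T = {p. divides_supernatural p (profinite_order G T)}"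

definition prime_complement :: "nat set \<Rightarrow> nat set" where
  "prime_complement \<pi> = {p. prime p \<and> p \<notin> \<pi>}"

definition hall_subgroup ::
  "nat set \<Rightarrow> 'a set \<Rightarrow> ('a, 'm) monoid_scheme \<Rightarrow> 'a topology \<Rightarrow> bool" where
  "hall_subgroup \<pi> H G T \<longleftrightarrow>
     subgroup H G \<and> closedin T H \<and>
     prime_divisors_of_order (G\<lparr>carrier := H\<rparr>) (subtopology T H) \<subseteq> \<pi> \<and>
     (\<forall>p\<in>\<pi>. \<not> divides_supernatural p (profinite_index G T H))"

section \<open>Haar measure and commuting probability\<close>

definition borel_of :: "'a topology \<Rightarrow> 'a measure" where
  "borel_of X = sigma (topspace X) {U. openin X U}"

definition regular_borel_prob :: "'a topology \<Rightarrow> 'a measure \<Rightarrow> bool" where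
  "regular_borel_prob X \<mu> \<longleftrightarrow>
     prob_space \<mu> \<and> sets \<mu> = sets (borel_of X) \<and>
     (\<forall>A\<in>sets \<mu>. emeasure \<mu> A = (INF U\<in>{U. openin X U \<and> A \<subseteq> U}. emeasure \<mu> U)) \<and>
     (\<forall>A\<in>sets \<mu>. emeasure \<mu> A =
        (SUP C\<in>{C. compactin X C \<and> closedin X C \<and> C \<subseteq> A}. emeasure \<mu> C))"

definition normalized_haar_measure ::
  "('a, 'm) monoid_scheme \<Rightarrow> 'a topology \<Rightarrow> 'a measure \<Rightarrow> bool" where
  "normalized_haar_measure G T \<mu> \<longleftrightarrow>
     regular_borel_prob T \<mu> \<and>
     (\<forall>g\<in>carrier G. \<forall>A\<in>sets \<mu>. emeasure \<mu> ((\<lambda>x. g \<otimes>\<^bsub>G\<^esub> x) ` A) = emeasure \<mu> A)"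

text \<open>The product \<open>\<mu> \<times> \<nu>\<close> as a regular Borel measure on \<open>X \<times> Y\<close>.  Without second countability
  the Borel sets of \<open>X \<times> Y\<close> can be strictly more than the product sigma-algebra underlying
  \<open>\<mu> \<Otimes>\<^sub>M \<nu>\<close>, and the closed set of commuting pairs need not lie in the latter (where its measure
  would default to 0).  For regular \<open>\<mu>\<close> and \<open>\<nu>\<close> on compact Hausdorff spaces, \<open>\<rho>\<close> exists and is
  unique.\<close>

definition product_measure_on ::
  "'a topology \<Rightarrow> 'b topology \<Rightarrow> 'a measure \<Rightarrow> 'b measure \<Rightarrow> ('a \<times> 'b) measure \<Rightarrow> bool" where
  "product_measure_on X Y \<mu> \<nu> \<rho> \<longleftrightarrow>
     regular_borel_prob (prod_topology X Y) \<rho> \<and>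
     (\<forall>A\<in>sets \<mu>. \<forall>B\<in>sets \<nu>. emeasure \<rho> (A \<times> B) = emeasure \<mu> A * emeasure \<nu> B)"

text \<open>\<open>has_commuting_probability G T H K p\<close> says that \<open>Pr(H, K) = p\<close>.  For closed subgroups of a
  compact Hausdorff group exactly one such \<open>p\<close> exists, since the Haar measures \<open>\<mu>\<close>, \<open>\<nu>\<close> and their
  product \<open>\<rho>\<close> exist and are unique.\<close>

definition has_commuting_probability ::
  "('a, 'm) monoid_scheme \<Rightarrow> 'a topology \<Rightarrow> 'a set \<Rightarrow> 'a set \<Rightarrow> real \<Rightarrow> bool" where
  "has_commuting_probability G T H K p \<longleftrightarrow>
     (\<exists>\<mu> \<nu> \<rho>.
        normalized_haar_measure (G\<lparr>carrier := H\<rparr>) (subtopology T H) \<mu> \<and>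
        normalized_haar_measure (G\<lparr>carrier := K\<rparr>) (subtopology T K) \<nu> \<and>
        product_measure_on (subtopology T H) (subtopology T K) \<mu> \<nu> \<rho> \<and>
        p = measure \<rho> {(x, y) \<in> H \<times> K. x \<otimes>\<^bsub>G\<^esub> y = y \<otimes>\<^bsub>G\<^esub> x})"

end

theory Submission
  imports Defs "HOL-Algebra.Zassenhaus" "HOL-Algebra.Sylow" "HOL-Algebra.Multiplicative_Group"
    "HOL-Library.Ramsey"
begin

text \<open>
  Suppose that \<open>G\<close> is not virtually pronilpotent. The idea is to find primes that \<open>G\<close> itself
  forces to interact: a set \<open>\<pi>\<close> for which the commuting probability of any Hall \<open>\<pi>\<close>-subgroup \<open>H\<close>
  and any Hall \<open>\<pi>'\<close>-subgroup \<open>K\<close> is \<open>0\<close>.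

  Let \<open>U\<close> be an open normal subgroup. As \<open>U\<close> is not pronilpotent, some finite quotient of \<open>G\<close> has a
  chief factor \<open>M/L\<close> with \<open>L \<le> M \<le> U\<close> that \<open>U\<close> does not centralize
  (\<open>nilpotent_if_centralizes_chief_factors\<close>). By solubility \<open>M/L\<close> is a \<open>p\<close>-group for some prime \<open>p\<close>.
  If \<open>U\<close> induced a \<open>p\<close>-group of automorphisms on \<open>M/L\<close>, the fixed points would form a nontrivial
  normal subgroup and \<open>U\<close> would act trivially; so another prime \<open>q\<close> divides the order of the induced
  group. Hence subgroups of index prime to \<open>p\<close> cover \<open>M/L\<close>, while every subgroup of index prime to
  \<open>q\<close> contains an element of \<open>U\<close> that acts nontrivially on \<open>M/L\<close>. This is what
  \<open>eccentric_section\<close> records.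

  Iterating with \<open>L\<close> in the place of \<open>U\<close> gives a descending chain of open normal subgroups \<open>U n\<close> and
  primes \<open>p n \<noteq> q n\<close>. Ramsey's theorem yields an infinite set \<open>S\<close> of indices with \<open>p i \<noteq> q j\<close> for all
  \<open>i, j \<in> S\<close> (\<open>infinite_subset_separating_pairs\<close>). Put \<open>\<pi> = {p i | i \<in> S}\<close>, so that all \<open>q j\<close> with
  \<open>j \<in> S\<close> lie in the complement of \<open>\<pi>\<close>.

  For an open normal subgroup \<open>N\<close> let \<open>P(N)\<close> be the probability that \<open>x \<in> H\<close> and \<open>y \<in> K\<close> commute
  modulo \<open>N\<close>; clearly \<open>Pr(H, K) \<le> P(N)\<close>. The core of the argument is the inequality
  \<open>P(L) \<le> 3/4 P(U)\<close> for an eccentric section \<open>M/L\<close> below \<open>U\<close> that \<open>H\<close> covers and on which some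
  element of \<open>K \<inter> U\<close> acts nontrivially (\<open>commuting_prob_mod_step\<close>). If \<open>y\<close> acts nontrivially on
  \<open>M/L\<close>, then the centralizer of \<open>y\<close> modulo \<open>L\<close> in \<open>H\<close> has index at least two in the centralizer
  modulo \<open>U\<close>; and \<open>y\<close> acts nontrivially with conditional probability at least one half on each coset of
  \<open>K \<inter> U\<close>. Every \<open>n \<in> S\<close> therefore contributes a factor \<open>3/4\<close>, and \<open>Pr(H, K) = 0\<close>.
\<close>

section \<open>Commutators and cosets modulo a normal subgroup\<close>

lemma (in group) commutator_eq_one_iff:
  assumes "x \<in> carrier G" "y \<in> carrier G"
  shows "x \<otimes> y \<otimes> inv x \<otimes> inv y = \<one> \<longleftrightarrow> x \<otimes> y = y \<otimes> x"
  using assms by (simp add: inv_solve_right')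

lemma (in group) subgroup_centralized:
  assumes H: "subgroup H G" and S: "S \<subseteq> carrier G"
  shows "subgroup {x \<in> H. \<forall>s\<in>S. x \<otimes> s = s \<otimes> x} G"
proof -
  interpret H: subgroup H G by fact
  have sG: "s \<in> carrier G" if "s \<in> S" for s
    using S that by blast
  show ?thesis
  proof (rule subgroupI)
    fix x assume x: "x \<in> {x \<in> H. \<forall>s\<in>S. x \<otimes> s = s \<otimes> x}"
    then have "inv x \<otimes> s = s \<otimes> inv x" if "s \<in> S" for s
      using sG[OF that] that by (simp add: inv_solve_left' inv_solve_right' m_assoc) (metis H.mem_carrier inv_closed inv_solve_right m_assoc m_closed)
    then show "inv x \<in> {x \<in> H. \<forall>s\<in>S. x \<otimes> s = s \<otimes> x}"
      using x by auto
  next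
    fix x y assume xy: "x \<in> {x \<in> H. \<forall>s\<in>S. x \<otimes> s = s \<otimes> x}" "y \<in> {x \<in> H. \<forall>s\<in>S. x \<otimes> s = s \<otimes> x}"
    have "x \<otimes> y \<otimes> s = s \<otimes> (x \<otimes> y)" if s: "s \<in> S" for s
    proof -
      have "x \<otimes> y \<otimes> s = x \<otimes> (s \<otimes> y)"
        using xy s sG[OF s] by (simp add: m_assoc)
      also have "\<dots> = s \<otimes> x \<otimes> y"
        using xy s sG[OF s] by (simp flip: m_assoc)
      finally show ?thesis
        using xy sG[OF s] by (simp add: m_assoc)
    qed
    then show "x \<otimes> y \<in> {x \<in> H. \<forall>s\<in>S. x \<otimes> s = s \<otimes> x}"
      using xy by auto
  qed (use sG in \<open>auto intro!: exI[of _ \<one>]\<close>)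
qed

lemma (in group_hom) commutator_mem_kernel_iff:
  assumes "x \<in> carrier G" "y \<in> carrier G"
  shows "x \<otimes> y \<otimes> inv x \<otimes> inv y \<in> kernel G H h \<longleftrightarrow> h x \<otimes>\<^bsub>H\<^esub> h y = h y \<otimes>\<^bsub>H\<^esub> h x"
  using H.commutator_eq_one_iff[of "h x" "h y"] assms by (simp add: kernel_def)

lemma (in group_hom) normal_vimage:
  assumes "N \<lhd> H"
  shows "{x \<in> carrier G. h x \<in> N} \<lhd> G"
proof -
  interpret N: normal N H by fact
  have "subgroup {x \<in> carrier G. h x \<in> N} G"
    by (rule G.subgroupI) (auto intro!: exI[of _ \<one>])
  then show ?thesis
    by (rule G.normal_invI) (auto simp: N.inv_op_closed2)
qed

lemma (in group_hom) mem_set_mult_kernel_iff: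
  assumes A: "subgroup A G" and x: "x \<in> carrier G"
  shows "x \<in> A <#> kernel G H h \<longleftrightarrow> h x \<in> h ` A"
proof
  assume "x \<in> A <#> kernel G H h"
  then show "h x \<in> h ` A"
    using subgroup.mem_carrier[OF A] by (auto simp: set_mult_def kernel_def)
next
  assume "h x \<in> h ` A"
  then obtain a where a: "a \<in> A" "h x = h a"
    by auto
  have aG: "a \<in> carrier G"
    using subgroup.mem_carrier[OF A a(1)] .
  then have "inv a \<otimes> x \<in> kernel G H h"
    using a x by (simp add: kernel_def)
  moreover have "x = a \<otimes> (inv a \<otimes> x)"
    using aG x by (simp flip: G.m_assoc)
  ultimately show "x \<in> A <#> kernel G H h"
    using a(1) by (auto simp: set_mult_def)
qed

text \<open>\<open>A ker h\<close> is the full preimage of \<open>h A\<close>, so taking images matches the cosets of the two subgroups.\<close>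

lemma (in group_hom) card_rcosets_set_mult_kernel:
  assumes surj: "h ` carrier G = carrier H" and A: "subgroup A G"
  shows "card (rcosets\<^bsub>G\<^esub> (A <#> kernel G H h)) = card (rcosets\<^bsub>H\<^esub> (h ` A))"
proof -
  define B where "B = A <#> kernel G H h"
  have B: "subgroup B G"
    unfolding B_def using G.mult_norm_subgroup[OF normal_kernel A] G.commut_normal[OF A normal_kernel] by simp
  have hA: "subgroup (h ` A) H"
    using subgroup_img_is_subgroup[OF A] .
  have memB: "x \<in> B \<longleftrightarrow> h x \<in> h ` A" if "x \<in> carrier G" for x
    unfolding B_def using mem_set_mult_kernel_iff[OF A that] .
  have hB: "h ` B = h ` A"
  proof
    show "h ` B \<subseteq> h ` A"
      using memB subgroup.mem_carrier[OF B] by auto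
    show "h ` A \<subseteq> h ` B"
      using memB subgroup.mem_carrier[OF A] by blast
  qed
  have coset: "h ` (B #> x) = h ` A #>\<^bsub>H\<^esub> h x" if "x \<in> carrier G" for x
    unfolding hB[symmetric] using that subgroup.mem_carrier[OF B] by (force simp: r_coset_def)
  have "bij_betw (\<lambda>C. h ` C) (rcosets\<^bsub>G\<^esub> B) (rcosets\<^bsub>H\<^esub> (h ` A))"
    unfolding bij_betw_def
  proof
    show "(\<lambda>C. h ` C) ` (rcosets\<^bsub>G\<^esub> B) = rcosets\<^bsub>H\<^esub> (h ` A)"
      unfolding RCOSETS_def surj[symmetric] using coset by auto
    show "inj_on (\<lambda>C. h ` C) (rcosets\<^bsub>G\<^esub> B)"
    proof (rule inj_onI)
      fix C D assume "C \<in> rcosets\<^bsub>G\<^esub> B" "D \<in> rcosets\<^bsub>G\<^esub> B" and eq: "h ` C = h ` D"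
      then obtain x y where xy: "x \<in> carrier G" "C = B #> x" "y \<in> carrier G" "D = B #> y"
        by (auto simp: RCOSETS_def)
      have "h x \<in> h ` A #>\<^bsub>H\<^esub> h y"
        using eq xy coset H.rcos_self[OF _ hA, of "h x"] by simp
      then have "h (x \<otimes> inv y) \<in> h ` A"
        using xy subgroup.rcos_module_imp[OF hA H.group_axioms, of "h y" "h x"] by simp
      then have "x \<in> B #> y"
        using xy memB subgroup.rcos_module_rev[OF B G.group_axioms, of y x] by simp
      then show "C = D"
        using xy G.repr_independence[OF _ _ B] by simp
    qed
  qed
  then show ?thesis
    unfolding B_def by (rule bij_betw_same_card)
qed

lemma (in normal) group_hom_r_coset: "group_hom G (G Mod H) (\<lambda>x. H #> x)"
  using factorgroup_is_group r_coset_hom_Mod by (intro group_hom.intro group_hom_axioms.intro) auto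

lemma (in normal) r_coset_eq_self_iff:
  assumes "x \<in> carrier G"
  shows "H #> x = H \<longleftrightarrow> x \<in> H"
  using coset_join1[OF _ assms subgroup_axioms] coset_join2[OF assms subgroup_axioms] by (rule iffI)

lemma (in normal) kernel_r_coset: "kernel G (G Mod H) (\<lambda>x. H #> x) = H"
proof -
  have "kernel G (G Mod H) (\<lambda>x. H #> x) = {x \<in> carrier G. x \<in> H}"
    unfolding kernel_def one_FactGroup by (intro Collect_cong conj_cong refl r_coset_eq_self_iff)
  then show ?thesis
    using subset by blast
qed

lemma (in normal) commutator_mem_iff:
  assumes x: "x \<in> carrier G" and y: "y \<in> carrier G"
  shows "x \<otimes> y \<otimes> inv x \<otimes> inv y \<in> H \<longleftrightarrow> H #> (x \<otimes> y) = H #> (y \<otimes> x)"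
proof -
  interpret q: group_hom G "G Mod H" "\<lambda>x. H #> x"
    by (rule group_hom_r_coset)
  show ?thesis
    using q.commutator_mem_kernel_iff[OF x y]
    unfolding kernel_r_coset q.hom_mult[OF x y, symmetric] q.hom_mult[OF y x, symmetric] .
qed

section \<open>Indices in finite groups\<close>

text \<open>The index of \<open>N \<inter> A\<close> in \<open>N\<close> divides the index of \<open>A\<close>, the quotient being the index of \<open>N A\<close>:
  this is the second isomorphism theorem, written without division.\<close>

lemma (in group) index_mult_card_Int_normal:
  assumes "finite (carrier G)" "subgroup A G" "N \<lhd> G"
  shows "\<exists>k. card (rcosets A) * card (N \<inter> A) = k * card N"
proof -
  interpret N: normal N G by fact
  have NA: "subgroup (N <#> A) G"
    using mult_norm_subgroup[OF assms(3,2)] .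
  have "N \<subseteq> N <#> A"
    using subgroup.one_closed[OF assms(2)] N.subset by (force simp: set_mult_def)
  then have N_NA: "subgroup N (G\<lparr>carrier := N <#> A\<rparr>)"
    using NA by (intro subgroup_incl N.subgroup_axioms)
  have NiA: "subgroup (N \<inter> A) (G\<lparr>carrier := A\<rparr>)"
    using subgroup_incl[OF subgroups_Inter_pair[OF N.subgroup_axioms assms(2)] assms(2)] by simp
  \<comment> \<open>The common order of \<open>N A / N\<close> and \<open>A / (N \<inter> A)\<close>.\<close>
  define i where "i = card (carrier (G\<lparr>carrier := A\<rparr> Mod (N \<inter> A)))"
  have "G\<lparr>carrier := N <#> A\<rparr> Mod N \<cong> G\<lparr>carrier := A\<rparr> Mod (N \<inter> A)"
    using weak_snd_iso_thme[OF assms(2,3)] .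
  then have i: "card (carrier (G\<lparr>carrier := N <#> A\<rparr> Mod N)) = i"
    unfolding i_def using iso_same_card by blast
  have 1: "i * card N = card (N <#> A)"
    using group.lagrange[OF subgroup_imp_group[OF NA] N_NA] i by (simp add: FactGroup_def order_def)
  have 2: "i * card (N \<inter> A) = card A"
    using group.lagrange[OF subgroup_imp_group[OF assms(2)] NiA] by (simp add: FactGroup_def order_def i_def)
  have 3: "card (rcosets (N <#> A)) * card (N <#> A) = card (rcosets A) * card A"
    using lagrange[OF NA] lagrange[OF assms(2)] by simp
  have "i > 0"
    using 2 subgroup.finite_imp_card_positive[OF assms(2,1)] by (cases i) auto
  moreover have "i * (card (rcosets A) * card (N \<inter> A)) = i * (card (rcosets (N <#> A)) * card N)"
    using 3 unfolding 1[symmetric] 2[symmetric] by (metis mult.left_commute)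
  ultimately show ?thesis by (metis mult_left_cancel less_not_refl)
qed

lemma (in group) card_subgroup_dvd:
  assumes "subgroup A G" "subgroup B G" "A \<subseteq> B"
  shows "card A dvd card B"
proof -
  have "card (rcosets\<^bsub>G\<lparr>carrier := B\<rparr>\<^esub> A) * card A = card B"
    using group.lagrange[OF subgroup_imp_group[OF assms(2)] subgroup_incl[OF assms]]
    by (simp add: order_def)
  then show ?thesis
    by (metis dvd_triv_right)
qed

text \<open>The index of \<open>N \<inter> A\<close> in \<open>N\<close> is a power of \<open>p\<close> dividing a number prime to \<open>p\<close>.\<close>

lemma (in group) normal_p_subgroup_subset_of_coprime_index:
  assumes fin: "finite (carrier G)" and A: "subgroup A G" and N: "N \<lhd> G"
    and p: "prime p" "card N = p ^ a" "\<not> p dvd card (rcosets A)"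
  shows "N \<subseteq> A"
proof -
  obtain k where k: "card (rcosets A) * card (N \<inter> A) = k * card N"
    using index_mult_card_Int_normal[OF fin A N] by blast
  have finN: "finite N"
    using fin finite_subset normal_imp_subgroup[OF N] subgroup.subset by blast
  have "coprime (card N) (card (rcosets A))"
    using p by (simp add: prime_imp_coprime)
  then have "card N dvd card (N \<inter> A)"
    using k by (metis coprime_dvd_mult_right_iff dvd_triv_right)
  then have "card N \<le> card (N \<inter> A)"
    using finN subgroup.one_closed[OF A] subgroup.one_closed[OF normal_imp_subgroup[OF N]]
    by (intro dvd_imp_le) (auto simp: card_gt_0_iff)
  then show ?thesis
    using card_seteq[OF finN inf_le1] by blast
qed

text \<open>If \<open>W \<inter> B \<le> D\<close>, then the index \<open>d\<close> of \<open>D\<close> in \<open>W\<close> divides the index of \<open>W \<inter> B\<close> in \<open>W\<close>, hence also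
  the index of \<open>B\<close>.\<close>

lemma (in group) coprime_index_Int_not_subset:
  assumes fin: "finite (carrier G)" and B: "subgroup B G" and W: "W \<lhd> G"
    and D: "subgroup D G" "D \<subseteq> W" and d: "card W = d * card D" "q dvd d"
    and q: "\<not> q dvd card (rcosets B)"
  shows "\<not> W \<inter> B \<subseteq> D"
proof
  assume sub: "W \<inter> B \<subseteq> D"
  have WB: "subgroup (W \<inter> B) G"
    using subgroups_Inter_pair[OF normal_imp_subgroup[OF W] B] .
  obtain e where e: "card D = card (W \<inter> B) * e"
    using card_subgroup_dvd[OF WB D(1) sub] by blast
  obtain k where "card (rcosets B) * card (W \<inter> B) = k * card W"
    using index_mult_card_Int_normal[OF fin B W] by blast
  then have "card (rcosets B) * card (W \<inter> B) = (k * (d * e)) * card (W \<inter> B)"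
    using d e by (simp add: ac_simps)
  moreover have "card (W \<inter> B) > 0"
    using subgroup.finite_imp_card_positive[OF WB fin] .
  ultimately show False
    using d(2) q by simp
qed

section \<open>Minimal normal subgroups of finite soluble groups\<close>

text \<open>Every orbit that is not a fixed point has length divisible by \<open>p\<close>, so the number of fixed points is
  congruent to \<open>card V\<close>, that is to \<open>0\<close>, modulo \<open>p\<close>; it cannot be \<open>1\<close>.\<close>

lemma (in group_action) exists_other_fixed_point:
  assumes fin: "finite V" and V: "V \<subseteq> E" "\<And>g v. g \<in> carrier G \<Longrightarrow> v \<in> V \<Longrightarrow> \<phi> g v \<in> V"
    and p: "prime p" "p dvd card V"
    and orb: "\<And>v. v \<in> V \<Longrightarrow> \<exists>k. card (orbit G \<phi> v) = p ^ k"
    and x: "x \<in> V" "\<And>g. g \<in> carrier G \<Longrightarrow> \<phi> g x = x"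
  shows "\<exists>y\<in>V. y \<noteq> x \<and> (\<forall>g\<in>carrier G. \<phi> g y = y)"
proof -
  interpret group_hom G "BijGroup E" \<phi> by (rule group_hom)
  have self: "v \<in> orbit G \<phi> v" if "v \<in> V" for v
    using orbit_refl that V by blast
  have orbV: "orbit G \<phi> v \<subseteq> V" if "v \<in> V" for v
    using V that by (auto simp: orbit_def)
  define Orb where "Orb = orbit G \<phi> ` V"
  have Un: "\<Union>Orb = V"
    using self orbV by (auto simp: Orb_def)
  have "pairwise disjnt Orb"
    using disjoint_union V by (fastforce simp: Orb_def pairwise_def disjnt_def orbits_def)
  then have card: "card V = (\<Sum>c\<in>Orb. card c)"
    using card_Union_disjoint[of Orb] Un fin by (metis finite_subset Union_upper)
  have xO: "orbit G \<phi> x = {x}"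
    using x(2) self[OF x(1)] by (auto simp: orbit_def)
  have "\<exists>c\<in>Orb - {{x}}. \<not> p dvd card c"
  proof (rule ccontr)
    assume "\<not> ?thesis"
    then have "p dvd (\<Sum>c\<in>Orb - {{x}}. card c)"
      by (intro dvd_sum) auto
    moreover have "card V = 1 + (\<Sum>c\<in>Orb - {{x}}. card c)"
      unfolding card using fin x(1) xO by (subst sum.remove[of _ "{x}"]) (auto simp: Orb_def)
    ultimately have "p dvd 1"
      using p(2) by (metis dvd_add_left_iff)
    then show False
      using p(1) by simp
  qed
  then obtain y where y: "y \<in> V" "orbit G \<phi> y \<noteq> {x}" "\<not> p dvd card (orbit G \<phi> y)"
    by (auto simp: Orb_def)
  obtain k where "card (orbit G \<phi> y) = p ^ k"
    using orb[OF y(1)] by blast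
  with y(3) have "card (orbit G \<phi> y) = 1"
    by (cases k) auto
  then have 1: "orbit G \<phi> y = {y}"
    using self[OF y(1)] by (metis card_1_singletonE singletonD)
  then have "\<phi> g y = y" if "g \<in> carrier G" for g
    using that by (auto simp: orbit_def)
  moreover have "y \<noteq> x"
    using 1 y(2) by auto
  ultimately show ?thesis
    using y(1) by blast
qed

text \<open>The derived subgroup of \<open>V\<close> is normal in \<open>G\<close>, hence trivial or \<open>V\<close>. A perfect \<open>V\<close> would be contained
  in every term of the derived series of \<open>G\<close>, which reaches the trivial group.\<close>

lemma (in group) minimal_normal_abelian:
  assumes sol: "solvable G" and V: "V \<lhd> G"
    and min: "\<And>X. X \<lhd> G \<Longrightarrow> X \<subseteq> V \<Longrightarrow> X = {\<one>} \<or> X = V"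
    and v: "v \<in> V" and w: "w \<in> V"
  shows "v \<otimes> w = w \<otimes> v"
proof -
  interpret V: normal V G by fact
  have "derived G V \<subseteq> V"
    using derived_incl[OF order_refl V.subgroup_axioms] .
  then consider "derived G V = {\<one>}" | "derived G V = V"
    using min derived_is_normal[OF V] by blast
  then show ?thesis
  proof cases
    case 1
    have "v \<otimes> w \<otimes> inv v \<otimes> inv w \<in> derived G V"
      unfolding derived_def using v w by (intro generate.incl) auto
    then show ?thesis
      using 1 v w commutator_eq_one_iff by auto
  next
    case 2
    obtain n where n: "(derived G ^^ n) (carrier G) = {\<one>}"
      using sol solvable_iff_trivial_derived_seq by blast
    have "(derived G ^^ n) V = V"
      using 2 by (induct n) auto
    then have "V \<subseteq> {\<one>}"
      using n mono_exp_of_derived[OF V.subset, of n] by auto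
    then show ?thesis
      using v w by auto
  qed
qed

text \<open>Any nontrivial element of the subgroup of order \<open>p\<^sup>a\<close> that Sylow's theorem provides will do.\<close>

lemma (in group) exists_nontrivial_prime_power_torsion:
  assumes fin: "finite (carrier G)" and V: "subgroup V G"
    and p: "prime p" and card: "card V = p ^ a * m" "a > 0"
  obtains x where "x \<in> V" "x \<noteq> \<one>" "x [^] (p ^ a) = \<one>"
proof -
  interpret V: subgroup V G by fact
  interpret VG: group "G\<lparr>carrier := V\<rparr>"
    using subgroup_imp_group[OF V] .
  have finV: "finite V"
    using fin finite_subset V.subset by blast
  obtain P where P: "subgroup P (G\<lparr>carrier := V\<rparr>)" "card P = p ^ a"
    using sylow_thm[OF p VG.group_axioms, of a m] card finV by (auto simp: order_def)
  have PV: "P \<subseteq> V"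
    using subgroup.subset[OF P(1)] by simp
  have PG: "subgroup P G"
    using incl_subgroup[OF V P(1)] .
  have "p ^ a > 1"
    using card(2) p prime_gt_1_nat one_less_power by blast
  then have "\<not> P \<subseteq> {\<one>}"
    using P(2) card_mono[of "{\<one>}" P] by auto
  then obtain x where x: "x \<in> P" "x \<noteq> \<one>"
    by auto
  have "x [^]\<^bsub>G\<lparr>carrier := P\<rparr>\<^esub> (p ^ a) = \<one>"
    using group.pow_order_eq_1[OF subgroup_imp_group[OF PG], of x] x P(2) by (simp add: order_def)
  then have "x [^] (p ^ a) = \<one>"
    by (simp add: nat_pow_def)
  then show ?thesis
    using that x PV by blast
qed

text \<open>With \<open>p\<^sup>a\<close> the \<open>p\<close>-part of \<open>card V\<close>, the elements of the abelian group \<open>V\<close> annihilated by \<open>p\<^sup>a\<close>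
  form a nontrivial normal subgroup \<open>X\<close> of \<open>G\<close>, so \<open>X = V\<close>. An element of a second prime order
  \<open>q\<close> would then have order dividing both \<open>q\<close> and \<open>p\<^sup>a\<close>.\<close>

lemma (in group) card_minimal_normal:
  assumes fin: "finite (carrier G)" and sol: "solvable G" and V: "V \<lhd> G" "V \<noteq> {\<one>}"
    and min: "\<And>X. X \<lhd> G \<Longrightarrow> X \<subseteq> V \<Longrightarrow> X = {\<one>} \<or> X = V"
  obtains p a where "prime p" "card V = p ^ a" "p dvd card V"
proof -
  interpret V: normal V G by (rule V)
  have comm: "v \<otimes> w = w \<otimes> v" if "v \<in> V" "w \<in> V" for v w
    using minimal_normal_abelian[OF sol V(1) min] that by blast
  have finV: "finite V"
    using fin finite_subset V.subset by blast
  have "card V \<noteq> 1"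
    using V(2) V.one_closed by (metis card_1_singletonE singletonD)
  then obtain p where p: "prime p" "p dvd card V"
    using prime_factor_nat by blast
  define a where "a = multiplicity p (card V)"
  obtain m where m: "card V = p ^ a * m" "\<not> p dvd m"
    using multiplicity_decompose'[of "card V" p] p finV V.one_closed unfolding a_def
    by (metis card_0_eq empty_iff not_prime_unit)
  have "a > 0"
    using p(2) m by (cases a) auto
  define X where "X = {v \<in> V. v [^] (p ^ a) = \<one>}"
  have pow: "(v \<otimes> w) [^] n = v [^] n \<otimes> w [^] n" if "v \<in> V" "w \<in> V" for v w and n :: nat
    using pow_mult_distrib[OF comm[OF that]] that by simp
  have "subgroup X G"
  proof (rule subgroupI)
    show "inv v \<in> X" if "v \<in> X" for v
      using that nat_pow_inv[of v "p ^ a"] by (auto simp: X_def)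
    show "v \<otimes> w \<in> X" if "v \<in> X" "w \<in> X" for v w
      using that pow by (auto simp: X_def)
  qed (auto simp: X_def intro!: exI[of _ \<one>])
  then have "X \<lhd> G"
  proof (rule normal_invI)
    fix x h assume x: "x \<in> carrier G" and h: "h \<in> X"
    have hG: "h \<in> carrier G"
      using h by (auto simp: X_def)
    have "(x \<otimes> h \<otimes> inv x) [^] n = x \<otimes> h [^] n \<otimes> inv x" for n :: nat
    proof (induct n)
      case (Suc n)
      then show ?case
        using x hG by (simp add: m_assoc inv_solve_left' flip: m_assoc[of "inv x" x])
    qed (use x in simp)
    then show "x \<otimes> h \<otimes> inv x \<in> X"
      using x h V.inv_op_closed2 by (auto simp: X_def)
  qed
  moreover obtain x where "x \<in> X" "x \<noteq> \<one>"
    using exists_nontrivial_prime_power_torsion[OF fin V.subgroup_axioms p(1) m(1) \<open>a > 0\<close>] by (auto simp: X_def)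
  ultimately have XV: "X = V"
    using min[of X] by (auto simp: X_def)
  have "m = 1"
  proof (rule ccontr)
    assume "m \<noteq> 1"
    then obtain q where q: "prime q" "q dvd m"
      using prime_factor_nat by blast
    obtain n where n: "card V = q ^ 1 * n"
      using q(2) m(1) by (metis dvd_def dvd_mult power_one_right)
    obtain y where y: "y \<in> V" "y \<noteq> \<one>" "y [^] (q ^ 1) = \<one>"
      using exists_nontrivial_prime_power_torsion[OF fin V.subgroup_axioms q(1) n] by auto
    have yG: "y \<in> carrier G"
      using y by auto
    have "y [^] (p ^ a) = \<one>"
      using XV y(1) by (auto simp: X_def)
    then have "ord y dvd p ^ a" "ord y dvd q"
      using y(3) yG pow_eq_id by auto
    moreover have "coprime (p ^ a) q"
      using p q m(2) by (metis coprime_power_left_iff primes_coprime)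
    ultimately have "ord y = 1"
      using coprime_common_divisor_nat by blast
    then show False
      using y(2) yG ord_eq_1 by blast
  qed
  then show ?thesis
    using that p m by auto
qed

text \<open>A nontrivial \<open>p\<close>-group acted on by a \<open>p\<close>-group has nontrivial fixed points: the orbits of \<open>W\<close> on \<open>V\<close>
  have length dividing \<open>p\<^sup>b\<close>. These fixed points form a normal subgroup of \<open>G\<close>, which is all of \<open>V\<close>
  by minimality.\<close>

lemma (in group) p_power_index_centralizes_minimal_normal:
  assumes fin: "finite (carrier G)" and V: "V \<lhd> G"
    and min: "\<And>X. X \<lhd> G \<Longrightarrow> X \<subseteq> V \<Longrightarrow> X = {\<one>} \<or> X = V"
    and p: "prime p" "p dvd card V"
    and W: "W \<lhd> G" and D: "D = {w \<in> W. \<forall>v\<in>V. w \<otimes> v = v \<otimes> w}" "subgroup D G"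
    and idx: "card W = p ^ b * card D"
  shows "D = W"
proof -
  interpret V: normal V G by (rule V)
  interpret W: normal W G by (rule W)
  define \<phi> where "\<phi> = (\<lambda>g. \<lambda>h\<in>carrier G. g \<otimes> h \<otimes> inv g)"
  interpret act: group_action "G\<lparr>carrier := W\<rparr>" "carrier G" \<phi>
    unfolding \<phi>_def using group_action.induced_action[OF action_by_conjugation W.subgroup_axioms] .
  have finV: "finite V"
    using fin finite_subset V.subset by blast
  have fixed_iff: "\<phi> g v = v \<longleftrightarrow> g \<otimes> v = v \<otimes> g" if "g \<in> W" "v \<in> V" for g v
    using that unfolding \<phi>_def by (simp add: inv_solve_right')
  have orb: "\<exists>k. card (orbit (G\<lparr>carrier := W\<rparr>) \<phi> v) = p ^ k" if v: "v \<in> V" for v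
  proof -
    let ?S = "stabilizer (G\<lparr>carrier := W\<rparr>) \<phi> v"
    have S: "subgroup ?S G"
      using incl_subgroup[OF W.subgroup_axioms act.stabilizer_subgroup] v V.subset by blast
    have "D \<subseteq> ?S"
      using D(1) fixed_iff v by (auto simp: stabilizer_def)
    then obtain s where s: "card ?S = card D * s"
      using card_subgroup_dvd[OF D(2) S] by blast
    have "card (orbit (G\<lparr>carrier := W\<rparr>) \<phi> v) * card ?S = card W"
      using act.orbit_stabilizer_theorem v V.subset by (auto simp: order_def)
    moreover have "card D > 0"
      using subgroup.finite_imp_card_positive[OF D(2) fin] .
    ultimately have "card (orbit (G\<lparr>carrier := W\<rparr>) \<phi> v) * s = p ^ b"
      using s idx by (simp add: ac_simps)
    then show ?thesis
      using p(1) by (metis divides_primepow_nat dvd_triv_left)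
  qed
  have inv: "\<phi> g v \<in> V" if "g \<in> W" "v \<in> V" for g v
    using that V.inv_op_closed2 by (auto simp: \<phi>_def)
  have fixed_one: "\<phi> g \<one> = \<one>" if "g \<in> W" for g
    using fixed_iff[OF that V.one_closed] that by simp
  have "\<exists>y\<in>V. y \<noteq> \<one> \<and> (\<forall>g\<in>carrier (G\<lparr>carrier := W\<rparr>). \<phi> g y = y)"
  proof (rule act.exists_other_fixed_point[OF finV V.subset _ p _ V.one_closed])
    show "\<phi> g v \<in> V" if "g \<in> carrier (G\<lparr>carrier := W\<rparr>)" "v \<in> V" for g v
      using inv that by simp
    show "\<phi> g \<one> = \<one>" if "g \<in> carrier (G\<lparr>carrier := W\<rparr>)" for g
      using fixed_one that by simp
    show "\<exists>k. card (orbit (G\<lparr>carrier := W\<rparr>) \<phi> v) = p ^ k" if "v \<in> V" for v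
      using orb[OF that] .
  qed
  then obtain y where y: "y \<in> V" "y \<noteq> \<one>" "\<And>g. g \<in> W \<Longrightarrow> \<phi> g y = y"
    by auto
  define Y where "Y = {v \<in> V. \<forall>g\<in>W. v \<otimes> g = g \<otimes> v}"
  have "subgroup Y G"
    unfolding Y_def using subgroup_centralized[OF V.subgroup_axioms W.subset] .
  then have "Y \<lhd> G"
  proof (rule normal_invI)
    fix x v assume x: "x \<in> carrier G" and v: "v \<in> Y"
    have "x \<otimes> v \<otimes> inv x \<otimes> g = g \<otimes> (x \<otimes> v \<otimes> inv x)" if g: "g \<in> W" for g
    proof -
      have "inv x \<otimes> g \<otimes> x \<in> W"
        using W.inv_op_closed1 x g by blast
      then have *: "v \<otimes> (inv x \<otimes> g \<otimes> x) = (inv x \<otimes> g \<otimes> x) \<otimes> v"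
        using v by (auto simp: Y_def)
      have vG: "v \<in> carrier G" and gG: "g \<in> carrier G"
        using v g by (auto simp: Y_def)
      have "x \<otimes> v \<otimes> inv x \<otimes> g = x \<otimes> (v \<otimes> (inv x \<otimes> g \<otimes> x)) \<otimes> inv x"
        using x vG gG by (simp add: m_assoc)
      also have "\<dots> = x \<otimes> ((inv x \<otimes> g \<otimes> x) \<otimes> v) \<otimes> inv x"
        using * by simp
      also have "\<dots> = g \<otimes> (x \<otimes> v \<otimes> inv x)"
        using x vG gG by (simp add: m_assoc flip: m_assoc[of x "inv x"])
      finally show ?thesis .
    qed
    then show "x \<otimes> v \<otimes> inv x \<in> Y"
      using x v V.inv_op_closed2 by (auto simp: Y_def)
  qed
  then have "Y = V"
    using min[of Y] y fixed_iff by (auto simp: Y_def)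
  then have "w \<otimes> v = v \<otimes> w" if "v \<in> V" "w \<in> W" for v w
    using that unfolding Y_def by (metis (mono_tags, lifting) mem_Collect_eq)
  then show ?thesis
    using D(1) by auto
qed

section \<open>Nilpotent groups and central chief factors\<close>

lemma (in group) one_mem_lower_central_series: "\<one> \<in> lower_central_series G n"
  by (cases n) (auto intro: generate.one)

lemma (in group) lower_central_series_Suc_subset:
  assumes U: "subgroup U G" and L: "subgroup L G" "L \<subseteq> U" and M: "M \<subseteq> U"
    and le: "lower_central_series (G\<lparr>carrier := U\<rparr>) n \<subseteq> M"
    and comm: "\<And>m u. m \<in> M \<Longrightarrow> u \<in> U \<Longrightarrow> m \<otimes> u \<otimes> inv m \<otimes> inv u \<in> L"
  shows "lower_central_series (G\<lparr>carrier := U\<rparr>) (Suc n) \<subseteq> L"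
proof -
  interpret U: group "G\<lparr>carrier := U\<rparr>"
    using subgroup_imp_group[OF U] .
  have "subgroup L (G\<lparr>carrier := U\<rparr>)"
    using subgroup_incl[OF L(1) U L(2)] .
  moreover have "h \<otimes> g \<otimes> inv\<^bsub>G\<lparr>carrier := U\<rparr>\<^esub> h \<otimes> inv\<^bsub>G\<lparr>carrier := U\<rparr>\<^esub> g \<in> L"
    if "h \<in> lower_central_series (G\<lparr>carrier := U\<rparr>) n" "g \<in> U" for h g
    using that le comm[of h g] M m_inv_consistent[OF U] by (metis subsetD)
  ultimately show ?thesis
    unfolding lower_central_series.simps by (intro U.generate_subgroup_incl) auto
qed

text \<open>Descend along a chief series of \<open>G\<close> below \<open>U\<close>: if a term of the lower central series of \<open>U\<close> lies in
  \<open>M\<close> and \<open>U\<close> centralizes the chief factor \<open>M/L\<close>, then the next term lies in \<open>L\<close>.\<close>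

lemma (in group) nilpotent_if_centralizes_chief_factors:
  assumes fin: "finite (carrier G)" and U: "U \<lhd> G"
    and chief: "\<And>L M. L \<lhd> G \<Longrightarrow> M \<lhd> G \<Longrightarrow> L \<subset> M \<Longrightarrow> M \<subseteq> U \<Longrightarrow>
      (\<And>X. X \<lhd> G \<Longrightarrow> L \<subseteq> X \<Longrightarrow> X \<subseteq> M \<Longrightarrow> X = L \<or> X = M) \<Longrightarrow>
      \<forall>m\<in>M. \<forall>u\<in>U. m \<otimes> u \<otimes> inv m \<otimes> inv u \<in> L"
  shows "nilpotent (G\<lparr>carrier := U\<rparr>)"
proof -
  interpret U: normal U G by (rule U)
  have step: "\<exists>m. lower_central_series (G\<lparr>carrier := U\<rparr>) m = {\<one>}"
    if "M \<lhd> G" "M \<subseteq> U" "lower_central_series (G\<lparr>carrier := U\<rparr>) n \<subseteq> M" for M n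
    using that
  proof (induction "card M" arbitrary: M n rule: less_induct)
    case less
    show ?case
    proof (cases "M = {\<one>}")
      case True
      then show ?thesis
        using less.prems(3) group.one_mem_lower_central_series[OF subgroup_imp_group[OF U.subgroup_axioms], of n]
        by (intro exI[of _ n]) auto
    next
      case False
      have oneM: "\<one> \<in> M"
        using less.prems(1) by (simp add: normal_imp_subgroup subgroup.one_closed)
      define S where "S = {L. L \<lhd> G \<and> L \<subset> M}"
      have "S \<subseteq> Pow (carrier G)"
        using normal_imp_subgroup subgroup.subset by (force simp: S_def)
      then have "finite S"
        using fin finite_subset by blast
      moreover have "{\<one>} \<in> S"
        using one_is_normal oneM False by (auto simp: S_def)
      ultimately obtain L where L: "L \<in> S" and max: "\<And>X. X \<in> S \<Longrightarrow> L \<subseteq> X \<Longrightarrow> L = X"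
        using finite_has_maximal[of S] by (metis empty_iff)
      have "\<forall>m\<in>M. \<forall>u\<in>U. m \<otimes> u \<otimes> inv m \<otimes> inv u \<in> L"
        using L max by (intro chief less.prems) (auto simp: S_def)
      then have "lower_central_series (G\<lparr>carrier := U\<rparr>) (Suc n) \<subseteq> L"
        using L less.prems by (intro lower_central_series_Suc_subset[OF U.subgroup_axioms])
          (auto simp: S_def normal_imp_subgroup)
      moreover have "finite M"
        using less.prems(2) fin U.subset by (meson finite_subset)
      then have "card L < card M"
        using L by (intro psubset_card_mono) (auto simp: S_def)
      ultimately show ?thesis
        using less.hyps[of L "Suc n"] L less.prems(2) by (auto simp: S_def)
    qed
  qed
  show ?thesis
    unfolding nilpotent_def using step[of U 0] U by simp
qed

lemma (in group) lower_central_series_in_carrier: "lower_central_series G n \<subseteq> carrier G"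
proof (induct n)
  case (Suc n)
  then show ?case
    unfolding lower_central_series.simps by (intro generate_incl) blast
qed simp

lemma (in group_hom) lower_central_series_img:
  assumes surj: "h ` carrier G = carrier H"
  shows "lower_central_series H n = h ` lower_central_series G n"
proof (induct n)
  case (Suc n)
  let ?K = "\<Union>a\<in>lower_central_series G n. \<Union>g\<in>carrier G. {a \<otimes> g \<otimes> inv a \<otimes> inv g}"
  have sub: "a \<in> carrier G" if "a \<in> lower_central_series G n" for a
    using that G.lower_central_series_in_carrier by blast
  then have "?K \<subseteq> carrier G"
    by blast
  moreover have "h ` ?K = (\<Union>a\<in>lower_central_series H n. \<Union>g\<in>carrier H. {a \<otimes>\<^bsub>H\<^esub> g \<otimes>\<^bsub>H\<^esub> inv\<^bsub>H\<^esub> a \<otimes>\<^bsub>H\<^esub> inv\<^bsub>H\<^esub> g})"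
    unfolding Suc surj[symmetric] using sub by (simp add: image_UN)
  ultimately show ?case
    using generate_img[of ?K] by simp
qed (simp add: surj)

lemma (in group_hom) nilpotent_img:
  assumes "h ` carrier G = carrier H" "nilpotent G"
  shows "nilpotent H"
  using assms lower_central_series_img[OF assms(1)] unfolding nilpotent_def
  by (metis hom_one image_empty image_insert)

section \<open>Eccentric sections\<close>

lemma power_if_unique_prime_factor:
  fixes d p :: nat
  assumes "d \<noteq> 0" "prime p" and unique: "\<And>q. prime q \<Longrightarrow> q dvd d \<Longrightarrow> q = p"
  shows "\<exists>b. d = p ^ b"
proof -
  obtain m where m: "d = p ^ multiplicity p d * m" "\<not> p dvd m"
    using multiplicity_decompose'[of d p] assms(1,2) not_prime_unit by blast
  have "m = 1"
    using m unique prime_factor_nat by (metis dvd_mult)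
  then show ?thesis
    using m(1) by auto
qed

text \<open>The subgroup \<open>V\<close> is a \<open>p\<close>-group, and the index in \<open>W\<close> of its centralizer is not a power of \<open>p\<close>,
  since otherwise \<open>W\<close> would centralize \<open>V\<close>; \<open>q\<close> is another prime divisor of that index.\<close>

lemma (in group) noncentral_minimal_normal:
  assumes fin: "finite (carrier G)" and sol: "solvable G" and V: "V \<lhd> G" and W: "W \<lhd> G"
    and min: "\<And>X. X \<lhd> G \<Longrightarrow> X \<subseteq> V \<Longrightarrow> X = {\<one>} \<or> X = V"
    and nc: "\<exists>v\<in>V. \<exists>w\<in>W. w \<otimes> v \<noteq> v \<otimes> w"
  obtains p q where "prime p" "prime q" "p \<noteq> q"
    "\<And>A. subgroup A G \<Longrightarrow> \<not> p dvd card (rcosets A) \<Longrightarrow> V \<subseteq> A"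
    "\<And>B. subgroup B G \<Longrightarrow> \<not> q dvd card (rcosets B) \<Longrightarrow> \<exists>w\<in>B \<inter> W. \<exists>v\<in>V. w \<otimes> v \<noteq> v \<otimes> w"
proof -
  interpret V: normal V G by (rule V)
  interpret W: normal W G by (rule W)
  have "V \<noteq> {\<one>}"
    using nc by auto
  then obtain p a where p: "prime p" "card V = p ^ a" "p dvd card V"
    using card_minimal_normal[OF fin sol V _ min] by blast
  define D where "D = {w \<in> W. \<forall>v\<in>V. w \<otimes> v = v \<otimes> w}"
  have D: "subgroup D G"
    unfolding D_def using subgroup_centralized[OF W.subgroup_axioms V.subset] .
  have DW: "D \<subseteq> W" "D \<noteq> W"
    using nc by (auto simp: D_def)
  obtain d where d: "card W = d * card D"
    using card_subgroup_dvd[OF D W.subgroup_axioms DW(1)] by (metis dvdE mult.commute)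
  have "d \<noteq> p ^ b" for b
    using p_power_index_centralizes_minimal_normal[OF fin V min p(1,3) W D_def D] d DW(2) by blast
  moreover have "d \<noteq> 0"
    using d W.finite_imp_card_positive[OF fin] by auto
  ultimately obtain q where q: "prime q" "q dvd d" "q \<noteq> p"
    using power_if_unique_prime_factor[OF _ p(1)] by blast
  show ?thesis
  proof (rule that[OF p(1) q(1) q(3)[symmetric]])
    show "V \<subseteq> A" if "subgroup A G" "\<not> p dvd card (rcosets A)" for A
      using normal_p_subgroup_subset_of_coprime_index[OF fin that(1) V p(1,2) that(2)] .
    show "\<exists>w\<in>B \<inter> W. \<exists>v\<in>V. w \<otimes> v \<noteq> v \<otimes> w" if "subgroup B G" "\<not> q dvd card (rcosets B)" for B
      using coprime_index_Int_not_subset[OF fin that(1) W D DW(1) d q(2) that(2)]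
      by (auto simp: D_def)
  qed
qed

text \<open>Think of a chief factor \<open>M/L\<close> of \<open>G\<close> below \<open>U\<close> that is a \<open>p\<close>-group and on which \<open>U\<close> acts as a group
  of order divisible by \<open>q\<close>. The definition keeps two consequences for subgroups of \<open>G\<close>, one for
  each prime: index prime to \<open>p\<close> implies covering \<open>M/L\<close>, and index prime to \<open>q\<close> implies containing an
  element of \<open>U\<close> that acts nontrivially on \<open>M/L\<close>. In this form it can be pulled back from a finite
  quotient, and it says about Hall subgroups exactly what the probabilistic estimate needs.\<close>

definition eccentric_section ::
  "('a, 'm) monoid_scheme \<Rightarrow> 'a set \<Rightarrow> 'a set \<Rightarrow> 'a set \<Rightarrow> nat \<Rightarrow> nat \<Rightarrow> bool" where
  "eccentric_section G U L M p q \<longleftrightarrow>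
     L \<lhd> G \<and> M \<lhd> G \<and> L \<subseteq> M \<and> M \<subseteq> U \<and> prime p \<and> prime q \<and> p \<noteq> q \<and>
     (\<forall>A. subgroup A G \<longrightarrow> \<not> p dvd card (rcosets\<^bsub>G\<^esub> (A <#>\<^bsub>G\<^esub> L)) \<longrightarrow> M \<subseteq> A <#>\<^bsub>G\<^esub> L) \<and>
     (\<forall>B. subgroup B G \<longrightarrow> \<not> q dvd card (rcosets\<^bsub>G\<^esub> (B <#>\<^bsub>G\<^esub> L)) \<longrightarrow>
        (\<exists>u\<in>B \<inter> U. \<exists>m\<in>M. m \<otimes>\<^bsub>G\<^esub> u \<otimes>\<^bsub>G\<^esub> inv\<^bsub>G\<^esub> m \<otimes>\<^bsub>G\<^esub> inv\<^bsub>G\<^esub> u \<notin> L))"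

lemma (in group_hom) eccentric_section_kernel:
  assumes surj: "h ` carrier G = carrier H" and fin: "finite (carrier H)" and sol: "solvable H"
    and U: "U \<lhd> G" and M: "M \<lhd> G" "kernel G H h \<subseteq> M" "M \<subseteq> U"
    and min: "\<And>X. X \<lhd> H \<Longrightarrow> X \<subseteq> h ` M \<Longrightarrow> X = {\<one>\<^bsub>H\<^esub>} \<or> X = h ` M"
    and nc: "\<exists>m\<in>M. \<exists>u\<in>U. h u \<otimes>\<^bsub>H\<^esub> h m \<noteq> h m \<otimes>\<^bsub>H\<^esub> h u"
  shows "\<exists>p q. eccentric_section G U (kernel G H h) M p q"
proof -
  have gh: "group_hom G H h" ..
  have hU: "h ` U \<lhd> H" and hM: "h ` M \<lhd> H"
    using normal.surj_hom_normal_subgroup[OF _ gh surj] U M(1) by auto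
  have UG: "u \<in> carrier G" if "u \<in> U" for u
    using that U normal_imp_subgroup subgroup.mem_carrier by fast
  obtain p q where pq: "prime p" "prime q" "p \<noteq> q"
    "\<And>A. subgroup A H \<Longrightarrow> \<not> p dvd card (rcosets\<^bsub>H\<^esub> A) \<Longrightarrow> h ` M \<subseteq> A"
    "\<And>B. subgroup B H \<Longrightarrow> \<not> q dvd card (rcosets\<^bsub>H\<^esub> B) \<Longrightarrow>
       \<exists>w\<in>B \<inter> h ` U. \<exists>v\<in>h ` M. w \<otimes>\<^bsub>H\<^esub> v \<noteq> v \<otimes>\<^bsub>H\<^esub> w"
    using H.noncentral_minimal_normal[OF fin sol hM hU min] nc by blast
  have "M \<subseteq> A <#> kernel G H h"
    if A: "subgroup A G" "\<not> p dvd card (rcosets\<^bsub>G\<^esub> (A <#> kernel G H h))" for A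
  proof -
    have "h ` M \<subseteq> h ` A"
      using pq(4)[OF subgroup_img_is_subgroup[OF A(1)]] A(2) card_rcosets_set_mult_kernel[OF surj A(1)] by simp
    then show ?thesis
      using mem_set_mult_kernel_iff[OF A(1)] M(3) UG by blast
  qed
  moreover have "\<exists>u\<in>B \<inter> U. \<exists>m\<in>M. m \<otimes> u \<otimes> inv m \<otimes> inv u \<notin> kernel G H h"
    if B: "subgroup B G" "\<not> q dvd card (rcosets\<^bsub>G\<^esub> (B <#> kernel G H h))" for B
  proof -
    obtain w v where wv: "w \<in> h ` B" "w \<in> h ` U" "v \<in> h ` M" "w \<otimes>\<^bsub>H\<^esub> v \<noteq> v \<otimes>\<^bsub>H\<^esub> w"
      using pq(5)[OF subgroup_img_is_subgroup[OF B(1)]] B(2) card_rcosets_set_mult_kernel[OF surj B(1)] by auto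
    obtain b u m where b: "b \<in> B" "w = h b" and u: "u \<in> U" "w = h u" and m: "m \<in> M" "v = h m"
      using wv by blast
    have bG: "b \<in> carrier G"
      using subgroup.mem_carrier[OF B(1) b(1)] .
    have "h b \<in> h ` U"
      using b u by (metis image_eqI)
    then have "b \<in> U <#> kernel G H h"
      using mem_set_mult_kernel_iff[OF normal_imp_subgroup[OF U] bG] by simp
    also have "\<dots> \<subseteq> U"
      using M(2,3) subgroup.m_closed[OF normal_imp_subgroup[OF U]] by (auto simp: set_mult_def)
    finally have "b \<in> U" .
    moreover have "m \<otimes> b \<otimes> inv m \<otimes> inv b \<notin> kernel G H h"
      using commutator_mem_kernel_iff[of m b] bG m b wv(4) M(3) UG by auto
    ultimately show ?thesis
      using b m by blast
  qed
  ultimately show ?thesis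
    unfolding eccentric_section_def using pq(1-3) normal_kernel M by blast
qed

text \<open>In \<open>H\<close> there is a chief factor \<open>M/L\<close> below \<open>h U\<close> that \<open>h U\<close> does not centralize. It becomes a
  minimal normal subgroup of \<open>H/L\<close>, and the section of \<open>G\<close> sought is its preimage under the
  composite homomorphism from \<open>G\<close> onto \<open>H/L\<close>.\<close>

lemma (in group_hom) not_nilpotent_imp_eccentric_section:
  assumes surj: "h ` carrier G = carrier H" and fin: "finite (carrier H)" and sol: "solvable H"
    and U: "U \<lhd> G" "kernel G H h \<subseteq> U" and not_nil: "\<not> nilpotent (H\<lparr>carrier := h ` U\<rparr>)"
  shows "\<exists>L M p q. kernel G H h \<subseteq> L \<and> eccentric_section G U L M p q"
proof -
  have gh: "group_hom G H h" ..
  have UG: "u \<in> carrier G" if "u \<in> U" for u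
    using that U normal_imp_subgroup subgroup.mem_carrier by fast
  have hU: "h ` U \<lhd> H"
    using normal.surj_hom_normal_subgroup[OF U(1) gh surj] .
  have "\<exists>L M. L \<lhd> H \<and> M \<lhd> H \<and> L \<subset> M \<and> M \<subseteq> h ` U \<and>
      (\<forall>X. X \<lhd> H \<longrightarrow> L \<subseteq> X \<longrightarrow> X \<subseteq> M \<longrightarrow> X = L \<or> X = M) \<and>
      \<not> (\<forall>m\<in>M. \<forall>u\<in>h ` U. m \<otimes>\<^bsub>H\<^esub> u \<otimes>\<^bsub>H\<^esub> inv\<^bsub>H\<^esub> m \<otimes>\<^bsub>H\<^esub> inv\<^bsub>H\<^esub> u \<in> L)"
  proof (rule ccontr)
    assume none: "\<not> ?thesis"
    have "nilpotent (H\<lparr>carrier := h ` U\<rparr>)"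
    proof (rule H.nilpotent_if_centralizes_chief_factors[OF fin hU])
      fix L M assume LM: "L \<lhd> H" "M \<lhd> H" "L \<subset> M" "M \<subseteq> h ` U"
        and chief: "\<And>X. X \<lhd> H \<Longrightarrow> L \<subseteq> X \<Longrightarrow> X \<subseteq> M \<Longrightarrow> X = L \<or> X = M"
      have "\<forall>X. X \<lhd> H \<longrightarrow> L \<subseteq> X \<longrightarrow> X \<subseteq> M \<longrightarrow> X = L \<or> X = M"
        using chief by simp
      with none LM show "\<forall>m\<in>M. \<forall>u\<in>h ` U. m \<otimes>\<^bsub>H\<^esub> u \<otimes>\<^bsub>H\<^esub> inv\<^bsub>H\<^esub> m \<otimes>\<^bsub>H\<^esub> inv\<^bsub>H\<^esub> u \<in> L"
        by meson
    qed
    with not_nil show False ..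
  qed
  then obtain L M where L: "L \<lhd> H" and M: "M \<lhd> H" and LM: "L \<subset> M" and MU: "M \<subseteq> h ` U"
    and chief: "\<forall>X. X \<lhd> H \<longrightarrow> L \<subseteq> X \<longrightarrow> X \<subseteq> M \<longrightarrow> X = L \<or> X = M"
    and nc: "\<not> (\<forall>m\<in>M. \<forall>u\<in>h ` U. m \<otimes>\<^bsub>H\<^esub> u \<otimes>\<^bsub>H\<^esub> inv\<^bsub>H\<^esub> m \<otimes>\<^bsub>H\<^esub> inv\<^bsub>H\<^esub> u \<in> L)"
    by (elim exE conjE)
  interpret L: normal L H by (rule L)
  interpret M: normal M H by (rule M)
  define R where "R = H Mod L"
  define \<pi> where "\<pi> = (\<lambda>y. L #>\<^bsub>H\<^esub> y)"
  interpret pi: group_hom H R \<pi>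
    unfolding R_def \<pi>_def by (rule L.group_hom_r_coset)
  have pi_surj: "\<pi> ` carrier H = carrier R"
    unfolding R_def \<pi>_def carrier_FactGroup ..
  have ker_pi: "kernel H R \<pi> = L"
    unfolding R_def \<pi>_def by (rule L.kernel_r_coset)
  define f where "f = \<pi> \<circ> h"
  interpret f: group_hom G R f
    unfolding f_def using Group.hom_compose[OF homh pi.homh] by (intro group_hom.intro group_hom_axioms.intro) auto
  have f_surj: "f ` carrier G = carrier R"
    unfolding f_def image_comp[symmetric] surj pi_surj ..
  \<comment> \<open>The kernel of \<open>f\<close> is the preimage of \<open>L\<close>, and \<open>M'\<close> is the preimage of \<open>M\<close>.\<close>
  define M' where "M' = {x \<in> carrier G. h x \<in> M}"
  have fM: "f ` M' = \<pi> ` M"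
  proof
    show "\<pi> ` M \<subseteq> f ` M'"
    proof
      fix z assume "z \<in> \<pi> ` M"
      then obtain y where y: "y \<in> M" "z = \<pi> y"
        by blast
      then obtain x where "x \<in> carrier G" "h x = y"
        using M.subset surj by (metis imageE subsetD)
      then show "z \<in> f ` M'"
        using y by (auto simp: f_def M'_def)
    qed
  qed (auto simp: f_def M'_def)
  have mem_ker_pi: "y \<in> L \<longleftrightarrow> \<pi> y = \<one>\<^bsub>R\<^esub>" if "y \<in> carrier H" for y
    using ker_pi that by (auto simp: kernel_def)
  have ker_f: "kernel G R f = {x \<in> carrier G. h x \<in> L}"
    using mem_ker_pi by (auto simp: kernel_def f_def)
  have "\<exists>p q. eccentric_section G U (kernel G R f) M' p q"
  proof (rule f.eccentric_section_kernel[OF f_surj _ _ U(1)])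
    show "finite (carrier R)"
      unfolding pi_surj[symmetric] using fin by simp
    show "solvable R"
      using pi.surj_hom_imp_solvable[OF pi_surj sol] .
    show "M' \<lhd> G"
      unfolding M'_def using normal_vimage[OF M] .
    show "kernel G R f \<subseteq> M'"
      unfolding ker_f M'_def using LM by auto
    show "M' \<subseteq> U"
    proof
      fix x assume x: "x \<in> M'"
      then have "x \<in> U <#> kernel G H h"
        using MU mem_set_mult_kernel_iff[OF normal_imp_subgroup[OF U(1)]] by (auto simp: M'_def)
      also have "\<dots> \<subseteq> U"
        using U(2) subgroup.m_closed[OF normal_imp_subgroup[OF U(1)]] by (auto simp: set_mult_def)
      finally show "x \<in> U" .
    qed
    show "X = {\<one>\<^bsub>R\<^esub>} \<or> X = f ` M'" if X: "X \<lhd> R" "X \<subseteq> f ` M'" for X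
    proof -
      define Y where "Y = {y \<in> carrier H. \<pi> y \<in> X}"
      have Y: "Y \<lhd> H"
        unfolding Y_def using pi.normal_vimage[OF X(1)] .
      have XR: "subgroup X R"
        using X(1) by (rule normal_imp_subgroup)
      have "X \<subseteq> \<pi> ` carrier H"
        using subgroup.subset[OF XR] pi_surj by simp
      then have piY: "\<pi> ` Y = X"
        unfolding Y_def by blast
      have "L \<subseteq> Y"
        using subgroup.one_closed[OF XR] mem_ker_pi L.subset by (auto simp: Y_def)
      moreover have "Y \<subseteq> M"
      proof
        fix y assume y: "y \<in> Y"
        then have yH: "y \<in> carrier H" and "\<pi> y \<in> \<pi> ` M"
          using X(2) fM by (auto simp: Y_def)
        then have "y \<in> M <#>\<^bsub>H\<^esub> L"
          using pi.mem_set_mult_kernel_iff[OF M.subgroup_axioms yH] ker_pi by simp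
        also have "\<dots> \<subseteq> M"
          using LM by (auto simp: set_mult_def)
        finally show "y \<in> M" .
      qed
      ultimately have "Y = L \<or> Y = M"
        using chief Y by blast
      moreover have "\<pi> ` L = {\<one>\<^bsub>R\<^esub>}"
        using mem_ker_pi L.subset imageI[OF L.one_closed, of \<pi>] by auto
      ultimately show ?thesis
        using piY fM by auto
    qed
    obtain m u where mu: "m \<in> M" "u \<in> U" "m \<otimes>\<^bsub>H\<^esub> h u \<otimes>\<^bsub>H\<^esub> inv\<^bsub>H\<^esub> m \<otimes>\<^bsub>H\<^esub> inv\<^bsub>H\<^esub> (h u) \<notin> L"
      using nc by blast
    obtain x where x: "x \<in> M'" "h x = m"
      using mu(1) MU UG unfolding M'_def by (metis (mono_tags, lifting) imageE mem_Collect_eq subsetD)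
    have "f u \<otimes>\<^bsub>R\<^esub> f x \<noteq> f x \<otimes>\<^bsub>R\<^esub> f u"
      using pi.commutator_mem_kernel_iff[of m "h u"] mu x UG unfolding ker_pi f_def by auto
    then show "\<exists>m\<in>M'. \<exists>u\<in>U. f u \<otimes>\<^bsub>R\<^esub> f m \<noteq> f m \<otimes>\<^bsub>R\<^esub> f u"
      using x mu by blast
  qed
  moreover have "kernel G H h \<subseteq> kernel G R f"
    unfolding ker_f by (auto simp: kernel_def)
  ultimately show ?thesis
    by blast
qed

section \<open>Centralizers modulo a normal subgroup\<close>

definition centralizer_mod :: "('a, 'm) monoid_scheme \<Rightarrow> 'a set \<Rightarrow> 'a set \<Rightarrow> 'a \<Rightarrow> 'a set" where
  "centralizer_mod G H N y = {x \<in> H. x \<otimes>\<^bsub>G\<^esub> y \<otimes>\<^bsub>G\<^esub> inv\<^bsub>G\<^esub> x \<otimes>\<^bsub>G\<^esub> inv\<^bsub>G\<^esub> y \<in> N}"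

lemma (in group_hom) subgroup_vimage_Int:
  assumes "subgroup A G" "subgroup B H"
  shows "subgroup {x \<in> A. h x \<in> B} G"
  using assms subgroup.mem_carrier[OF assms(1)]
  by (intro G.subgroupI) (auto intro!: exI[of _ \<one>] simp: subgroup.one_closed subgroup.m_closed subgroup.m_inv_closed)

lemma (in group) subgroup_centralizing_mod:
  assumes N: "N \<lhd> G" and H: "subgroup H G" and S: "S \<subseteq> carrier G"
  shows "subgroup {x \<in> H. \<forall>s\<in>S. x \<otimes> s \<otimes> inv x \<otimes> inv s \<in> N} G"
proof -
  interpret N: normal N G by fact
  interpret q: group_hom G "G Mod N" "\<lambda>x. N #> x"
    by (rule N.group_hom_r_coset)
  let ?C = "{z \<in> carrier (G Mod N). \<forall>t\<in>(\<lambda>x. N #> x) ` S. z \<otimes>\<^bsub>G Mod N\<^esub> t = t \<otimes>\<^bsub>G Mod N\<^esub> z}"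
  have sG: "s \<in> carrier G" if "s \<in> S" for s
    using S that by blast
  have "subgroup ?C (G Mod N)"
    using S q.hom_closed by (intro q.H.subgroup_centralized q.H.subgroup_self) auto
  then have sub: "subgroup {x \<in> H. N #> x \<in> ?C} G"
    by (rule q.subgroup_vimage_Int[OF H])
  have iff: "N #> x \<in> ?C \<longleftrightarrow> (\<forall>s\<in>S. x \<otimes> s \<otimes> inv x \<otimes> inv s \<in> N)" if "x \<in> H" for x
  proof -
    have x: "x \<in> carrier G"
      using subgroup.mem_carrier[OF H that] .
    have "(N #> x) \<otimes>\<^bsub>G Mod N\<^esub> (N #> s) = N #> (x \<otimes> s)" "(N #> s) \<otimes>\<^bsub>G Mod N\<^esub> (N #> x) = N #> (s \<otimes> x)"
      if "s \<in> S" for s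
      by (simp_all only: q.hom_mult[OF x sG[OF that]] q.hom_mult[OF sG[OF that] x])
    then show ?thesis
      using N.commutator_mem_iff[OF x] sG q.hom_closed[OF x] by auto
  qed
  have "{x \<in> H. N #> x \<in> ?C} = {x \<in> H. \<forall>s\<in>S. x \<otimes> s \<otimes> inv x \<otimes> inv s \<in> N}"
    by (rule Collect_cong) (use iff in blast)
  with sub show ?thesis
    by (simp only:)
qed

lemma (in group) subgroup_centralizer_mod:
  assumes "N \<lhd> G" "subgroup H G" "y \<in> carrier G"
  shows "subgroup (centralizer_mod G H N y) G"
  using subgroup_centralizing_mod[OF assms(1,2), of "{y}"] assms(3) by (simp add: centralizer_mod_def)

lemma (in group) commutator_mod_cong:
  assumes N: "N \<lhd> G" and "x \<in> carrier G" "x' \<in> carrier G" "y \<in> carrier G" "y' \<in> carrier G"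
    and "N #> x = N #> x'" "N #> y = N #> y'"
  shows "x \<otimes> y \<otimes> inv x \<otimes> inv y \<in> N \<longleftrightarrow> x' \<otimes> y' \<otimes> inv x' \<otimes> inv y' \<in> N"
proof -
  interpret N: normal N G by fact
  interpret q: group_hom G "G Mod N" "\<lambda>x. N #> x"
    by (rule N.group_hom_r_coset)
  have "N #> (x \<otimes> y) = N #> (x' \<otimes> y')" "N #> (y \<otimes> x) = N #> (y' \<otimes> x')"
    by (simp_all only: q.hom_mult[OF assms(2,4)] q.hom_mult[OF assms(3,5)] q.hom_mult[OF assms(4,2)]
        q.hom_mult[OF assms(5,3)] assms(6,7))
  then show ?thesis
    by (simp only: N.commutator_mem_iff[OF assms(2,4)] N.commutator_mem_iff[OF assms(3,5)])
qed

lemma (in group) centralizer_mod_cong: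
  assumes "N \<lhd> G" "subgroup H G" "y \<in> carrier G" "y' \<in> carrier G" "N #> y = N #> y'"
  shows "centralizer_mod G H N y = centralizer_mod G H N y'"
  unfolding centralizer_mod_def
  by (intro Collect_cong conj_cong refl commutator_mod_cong[OF assms(1) _ _ assms(3,4) refl assms(5)]
      subgroup.mem_carrier[OF assms(2)])

lemma (in group) r_coset_mult_normal:
  assumes "N \<lhd> G" "y \<in> carrier G" "n \<in> N"
  shows "N #> (y \<otimes> n) = N #> y" "N #> (n \<otimes> y) = N #> y"
proof -
  interpret N: normal N G by fact
  interpret q: group_hom G "G Mod N" "\<lambda>x. N #> x"
    by (rule N.group_hom_r_coset)
  have nG: "n \<in> carrier G" and n: "N #> n = \<one>\<^bsub>G Mod N\<^esub>"
    using N.rcos_const[OF is_group assms(3)] assms(3) by auto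
  show "N #> (y \<otimes> n) = N #> y"
    unfolding q.hom_mult[OF assms(2) nG] n using q.hom_closed[OF assms(2)] by (rule q.H.r_one)
  show "N #> (n \<otimes> y) = N #> y"
    unfolding q.hom_mult[OF nG assms(2)] n using q.hom_closed[OF assms(2)] by (rule q.H.l_one)
qed

section \<open>Haar measure on a topological group\<close>

lemma topological_group_left_mult:
  assumes "topological_group G T" "g \<in> carrier G"
  shows "continuous_map T T (\<lambda>x. g \<otimes>\<^bsub>G\<^esub> x)"
proof -
  have "continuous_map T (prod_topology T T) (\<lambda>x. (g, x))"
    using assms by (intro continuous_map_pairedI) (auto simp: topological_group_def)
  then have "continuous_map T T ((\<lambda>(x, y). x \<otimes>\<^bsub>G\<^esub> y) \<circ> (\<lambda>x. (g, x)))"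
    using assms(1) by (intro continuous_map_compose) (auto simp: topological_group_def)
  then show ?thesis
    by (simp add: o_def)
qed

text \<open>A subset of \<open>H\<close> defined by conditions modulo an open normal subgroup is the trace on \<open>H\<close> of a union
  of cosets of that subgroup. This makes all sets in the probabilistic argument open, hence Borel.\<close>

lemma openin_union_of_cosets:
  fixes G (structure)
  assumes top: "topological_group G T" and N: "subgroup N G" "openin T N" and H: "subgroup H G"
    and S: "S \<subseteq> H" "\<And>s n. s \<in> S \<Longrightarrow> n \<in> H \<inter> N \<Longrightarrow> s \<otimes> n \<in> S"
  shows "openin (subtopology T H) S"
proof -
  interpret group G
    using top by (simp add: topological_group_def)
  interpret H: subgroup H G by fact
  interpret N: subgroup N G by fact
  have T: "topspace T = carrier G"
    using top by (simp add: topological_group_def)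
  define O' where "O' s = {x \<in> topspace T. inv s \<otimes> x \<in> N}" for s
  have "openin T (O' s)" if "s \<in> S" for s
    unfolding O'_def using that S(1) H.mem_carrier
    by (intro openin_continuous_map_preimage[OF topological_group_left_mult[OF top] N(2)]) blast
  then have "openin T (\<Union>s\<in>S. O' s)"
    by blast
  moreover have "S = (\<Union>s\<in>S. O' s) \<inter> H"
  proof
    have "s \<in> O' s" if "s \<in> S" for s
    proof -
      have "s \<in> carrier G"
        using that S(1) H.mem_carrier by blast
      then show ?thesis
        using T N.one_closed by (simp add: O'_def)
    qed
    then show "S \<subseteq> (\<Union>s\<in>S. O' s) \<inter> H"
      using S(1) by blast
    show "(\<Union>s\<in>S. O' s) \<inter> H \<subseteq> S"
    proof
      fix x assume "x \<in> (\<Union>s\<in>S. O' s) \<inter> H"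
      then obtain s where s: "s \<in> S" "inv s \<otimes> x \<in> N" "x \<in> H"
        by (auto simp: O'_def)
      then have "s \<in> H"
        using S(1) by blast
      then have "s \<otimes> (inv s \<otimes> x) \<in> S"
        using s by (intro S(2)) auto
      moreover have "s \<otimes> (inv s \<otimes> x) = x"
        using \<open>s \<in> H\<close> s(3) by (simp flip: m_assoc)
      ultimately show "x \<in> S" by simp
    qed
  qed
  ultimately show ?thesis
    unfolding openin_subtopology by blast
qed

lemma sets_borel_of: "sets (borel_of X) = sigma_sets (topspace X) {U. openin X U}"
  unfolding borel_of_def by (intro sets_measure_of) (auto dest: openin_subset)

lemma space_borel_of: "space (borel_of X) = topspace X"
  unfolding borel_of_def by (intro space_measure_of) (auto dest: openin_subset)

lemma regular_borel_prob_sets: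
  assumes "regular_borel_prob X \<mu>"
  shows "sets \<mu> = sets (borel_of X)" "space \<mu> = topspace X" "prob_space \<mu>"
    "openin X A \<Longrightarrow> A \<in> sets \<mu>"
proof -
  show sets: "sets \<mu> = sets (borel_of X)" and "prob_space \<mu>"
    using assms by (auto simp: regular_borel_prob_def)
  then show "space \<mu> = topspace X"
    using sets_eq_imp_space_eq[OF sets] by (simp add: space_borel_of)
  show "openin X A \<Longrightarrow> A \<in> sets \<mu>"
    unfolding sets sets_borel_of by (auto intro: sigma_sets.Basic)
qed

lemma topological_group_subgroup:
  assumes "topological_group G T" "subgroup H G"
  shows "topological_group (G\<lparr>carrier := H\<rparr>) (subtopology T H)"
proof -
  interpret group G
    using assms(1) by (simp add: topological_group_def)
  interpret H: subgroup H G by fact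
  have T: "topspace T = carrier G" and mult: "continuous_map (prod_topology T T) T (\<lambda>(x, y). x \<otimes>\<^bsub>G\<^esub> y)"
    and inv: "continuous_map T T (\<lambda>x. inv\<^bsub>G\<^esub> x)"
    using assms(1) by (auto simp: topological_group_def)
  have "continuous_map (prod_topology (subtopology T H) (subtopology T H)) (subtopology T H) (\<lambda>(x, y). x \<otimes>\<^bsub>G\<^esub> y)"
    unfolding prod_topology_subtopology subtopology_subtopology
    by (intro continuous_map_into_subtopology continuous_map_from_subtopology mult) auto
  moreover have "continuous_map (subtopology T H) (subtopology T H) (\<lambda>x. inv\<^bsub>G\<^esub> x)"
    by (intro continuous_map_into_subtopology continuous_map_from_subtopology inv) (auto simp: H.m_inv_closed)
  then have "continuous_map (subtopology T H) (subtopology T H) (\<lambda>x. inv\<^bsub>G\<lparr>carrier := H\<rparr>\<^esub> x)"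
    by (rule continuous_map_eq) (use m_inv_consistent[OF assms(2)] in auto)
  ultimately show ?thesis
    unfolding topological_group_def using subgroup_imp_group[OF assms(2)] T H.subset by auto
qed

lemma haar_measurable_left_mult:
  assumes "topological_group G T" "regular_borel_prob T \<mu>" "g \<in> carrier G"
  shows "(\<lambda>x. g \<otimes>\<^bsub>G\<^esub> x) \<in> measurable \<mu> \<mu>"
proof (rule measurable_sigma_sets)
  have cont: "continuous_map T T (\<lambda>x. g \<otimes>\<^bsub>G\<^esub> x)"
    using topological_group_left_mult[OF assms(1,3)] .
  note \<mu> = regular_borel_prob_sets[OF assms(2)]
  show "sets \<mu> = sigma_sets (topspace T) {U. openin T U}"
    using \<mu>(1) by (simp add: sets_borel_of)
  show "{U. openin T U} \<subseteq> Pow (topspace T)"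
    by (auto dest: openin_subset)
  show "(\<lambda>x. g \<otimes>\<^bsub>G\<^esub> x) \<in> space \<mu> \<rightarrow> topspace T"
    using cont \<mu>(2) by (auto simp: continuous_map_def)
  show "(\<lambda>x. g \<otimes>\<^bsub>G\<^esub> x) -` U \<inter> space \<mu> \<in> sets \<mu>" if "U \<in> {U. openin T U}" for U
  proof -
    have "openin T {x \<in> topspace T. g \<otimes>\<^bsub>G\<^esub> x \<in> U}"
      using openin_continuous_map_preimage[OF cont] that by blast
    moreover have "(\<lambda>x. g \<otimes>\<^bsub>G\<^esub> x) -` U \<inter> space \<mu> = {x \<in> topspace T. g \<otimes>\<^bsub>G\<^esub> x \<in> U}"
      using \<mu>(2) by auto
    ultimately show ?thesis
      using \<mu>(4) by simp
  qed
qed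

text \<open>Invariance as an identity of image measures allows translating the variable of an integral.\<close>

lemma haar_distr_left_mult:
  assumes top: "topological_group G T" and \<mu>: "normalized_haar_measure G T \<mu>" and g: "g \<in> carrier G"
  shows "distr \<mu> \<mu> (\<lambda>x. g \<otimes>\<^bsub>G\<^esub> x) = \<mu>"
proof (rule measure_eqI)
  interpret group G
    using top by (simp add: topological_group_def)
  have reg: "regular_borel_prob T \<mu>"
    using \<mu> by (simp add: normalized_haar_measure_def)
  have sp: "space \<mu> = carrier G"
    using regular_borel_prob_sets(2)[OF reg] top by (simp add: topological_group_def)
  fix A assume "A \<in> sets (distr \<mu> \<mu> (\<lambda>x. g \<otimes>\<^bsub>G\<^esub> x))"
  then have A: "A \<in> sets \<mu>"
    by simp
  then have AG: "A \<subseteq> carrier G"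
    using sets.sets_into_space sp by blast
  have "(\<lambda>x. g \<otimes>\<^bsub>G\<^esub> x) -` A \<inter> space \<mu> = (\<lambda>x. inv\<^bsub>G\<^esub> g \<otimes>\<^bsub>G\<^esub> x) ` A"
  proof
    show "(\<lambda>x. g \<otimes>\<^bsub>G\<^esub> x) -` A \<inter> space \<mu> \<subseteq> (\<lambda>x. inv\<^bsub>G\<^esub> g \<otimes>\<^bsub>G\<^esub> x) ` A"
    proof
      fix x assume x: "x \<in> (\<lambda>x. g \<otimes>\<^bsub>G\<^esub> x) -` A \<inter> space \<mu>"
      then have "x = inv\<^bsub>G\<^esub> g \<otimes>\<^bsub>G\<^esub> (g \<otimes>\<^bsub>G\<^esub> x)"
        using g sp by (simp flip: m_assoc)
      then show "x \<in> (\<lambda>x. inv\<^bsub>G\<^esub> g \<otimes>\<^bsub>G\<^esub> x) ` A"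
        using x by blast
    qed
    show "(\<lambda>x. inv\<^bsub>G\<^esub> g \<otimes>\<^bsub>G\<^esub> x) ` A \<subseteq> (\<lambda>x. g \<otimes>\<^bsub>G\<^esub> x) -` A \<inter> space \<mu>"
      using g sp AG by (auto simp: subset_iff simp flip: m_assoc)
  qed
  then show "emeasure (distr \<mu> \<mu> (\<lambda>x. g \<otimes>\<^bsub>G\<^esub> x)) A = emeasure \<mu> A"
    using emeasure_distr[OF haar_measurable_left_mult[OF top reg g] A] \<mu> A g
    by (simp add: normalized_haar_measure_def)
qed simp

section \<open>The commuting probability modulo an open normal subgroup\<close>

locale haar_pair = group G for G :: "('a, 'm) monoid_scheme" (structure) +
  fixes T :: "'a topology" and H K :: "'a set" and \<mu> \<nu> :: "'a measure"
  assumes top: "topological_group G T"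
    and H: "subgroup H G" and K: "subgroup K G"
    and \<mu>: "normalized_haar_measure (G\<lparr>carrier := H\<rparr>) (subtopology T H) \<mu>"
    and \<nu>: "normalized_haar_measure (G\<lparr>carrier := K\<rparr>) (subtopology T K) \<nu>"
begin

sublocale H: subgroup H G by (rule H)
sublocale K: subgroup K G by (rule K)

lemma topspace_eq: "topspace T = carrier G"
  using top by (simp add: topological_group_def)

lemma reg: "regular_borel_prob (subtopology T H) \<mu>" "regular_borel_prob (subtopology T K) \<nu>"
  using \<mu> \<nu> by (simp_all add: normalized_haar_measure_def)

lemma space: "space \<mu> = H" "space \<nu> = K"
  using regular_borel_prob_sets(2)[OF reg(1)] regular_borel_prob_sets(2)[OF reg(2)]
    topspace_eq H.subset K.subset by auto

sublocale \<mu>: prob_space \<mu> by (rule regular_borel_prob_sets(3)[OF reg(1)])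
sublocale \<nu>: prob_space \<nu> by (rule regular_borel_prob_sets(3)[OF reg(2)])

lemma open_sets:
  assumes N: "N \<lhd> G" "openin T N"
  shows "S \<subseteq> H \<Longrightarrow> (\<And>s n. s \<in> S \<Longrightarrow> n \<in> H \<inter> N \<Longrightarrow> s \<otimes> n \<in> S) \<Longrightarrow> openin (subtopology T H) S \<and> S \<in> sets \<mu>"
    and "S' \<subseteq> K \<Longrightarrow> (\<And>s n. s \<in> S' \<Longrightarrow> n \<in> K \<inter> N \<Longrightarrow> s \<otimes> n \<in> S') \<Longrightarrow> openin (subtopology T K) S' \<and> S' \<in> sets \<nu>"
  using openin_union_of_cosets[OF top normal_imp_subgroup[OF N(1)] N(2) H, of S]
    openin_union_of_cosets[OF top normal_imp_subgroup[OF N(1)] N(2) K, of S']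
    regular_borel_prob_sets(4)[OF reg(1)] regular_borel_prob_sets(4)[OF reg(2)] by simp_all

lemma openin_centralizer_mod:
  assumes N: "N \<lhd> G" "openin T N" and y: "y \<in> carrier G"
  shows "openin (subtopology T H) (centralizer_mod G H N y) \<and> centralizer_mod G H N y \<in> sets \<mu>"
proof (rule open_sets(1)[OF N])
  fix s n assume s: "s \<in> centralizer_mod G H N y" and n: "n \<in> H \<inter> N"
  then have "s \<in> H" "n \<in> H"
    by (auto simp: centralizer_mod_def)
  then have "N #> (s \<otimes> n) = N #> s" "s \<otimes> n \<in> H"
    using r_coset_mult_normal(1)[OF N(1), of s n] n by auto
  then show "s \<otimes> n \<in> centralizer_mod G H N y"
    using s commutator_mod_cong[OF N(1), of "s \<otimes> n" s y y] y \<open>s \<in> H\<close> by (simp add: centralizer_mod_def)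
qed (auto simp: centralizer_mod_def)

lemma measurable_coset_function:
  fixes f :: "'a \<Rightarrow> ennreal"
  assumes N: "N \<lhd> G" "openin T N" and f: "\<And>y y'. y \<in> K \<Longrightarrow> y' \<in> K \<Longrightarrow> N #> y = N #> y' \<Longrightarrow> f y = f y'"
  shows "f \<in> borel_measurable \<nu>"
proof (rule measurableI)
  fix A :: "ennreal set"
  have "f (y \<otimes> n) = f y" if "y \<in> K" "n \<in> K \<inter> N" for y n
    using that r_coset_mult_normal(1)[OF N(1), of y n] by (intro f) auto
  then show "f -` A \<inter> space \<nu> \<in> sets \<nu>"
    using open_sets(2)[OF N, of "f -` A \<inter> K"] space by auto
qed simp

text \<open>The \<open>\<mu> \<times> \<nu>\<close>-measure of the set of pairs that commute modulo \<open>N\<close>, computed by Fubini: its section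
  at \<open>y\<close> is the subgroup \<open>centralizer_mod G H N y\<close>. As an iterated integral it involves no choice of a
  product measure.\<close>

definition commuting_prob_mod :: "'a set \<Rightarrow> ennreal" where
  "commuting_prob_mod N = (\<integral>\<^sup>+ y. emeasure \<mu> (centralizer_mod G H N y) \<partial>\<nu>)"

lemma measurable_centralizer_mod:
  assumes "N \<lhd> G" "openin T N"
  shows "(\<lambda>y. emeasure \<mu> (centralizer_mod G H N y)) \<in> borel_measurable \<nu>"
  by (rule measurable_coset_function[OF assms])
    (intro arg_cong[of _ _ "emeasure \<mu>"] centralizer_mod_cong[OF assms(1) H K.mem_carrier K.mem_carrier])

lemma commuting_prob_mod_le_one: "commuting_prob_mod N \<le> 1"
proof -
  have "commuting_prob_mod N \<le> (\<integral>\<^sup>+ y. 1 \<partial>\<nu>)"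
    unfolding commuting_prob_mod_def by (intro nn_integral_mono \<mu>.emeasure_le_1)
  then show ?thesis
    by (simp add: \<nu>.emeasure_space_1)
qed

lemma centralizer_mod_mono: "L \<subseteq> U \<Longrightarrow> centralizer_mod G H L y \<subseteq> centralizer_mod G H U y"
  by (auto simp: centralizer_mod_def)

lemma commuting_prob_mod_mono:
  assumes "L \<subseteq> U" "U \<lhd> G" "openin T U"
  shows "commuting_prob_mod L \<le> commuting_prob_mod U"
  unfolding commuting_prob_mod_def
  using openin_centralizer_mod[OF assms(2,3)] centralizer_mod_mono[OF assms(1)] space
  by (intro nn_integral_mono emeasure_mono) auto

text \<open>A coset \<open>c A\<close> with \<open>c \<in> B - A\<close> is disjoint from \<open>A\<close>, lies in \<open>B\<close> and has the same measure as \<open>A\<close>.\<close>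

lemma emeasure_proper_subgroup:
  assumes A: "subgroup A G" "A \<in> sets \<mu>" and B: "subgroup B G" "B \<in> sets \<mu>" and sub: "A \<subseteq> B" "A \<noteq> B"
  shows "2 * emeasure \<mu> A \<le> emeasure \<mu> B"
proof -
  obtain c where c: "c \<in> B" "c \<notin> A"
    using sub by blast
  have BH: "B \<subseteq> H"
    using sets.sets_into_space[OF B(2)] space by simp
  then have cH: "c \<in> H"
    using c by blast
  let ?cA = "(\<lambda>x. c \<otimes> x) ` A"
  have cA: "emeasure \<mu> ?cA = emeasure \<mu> A"
    using \<mu> cH A(2) unfolding normalized_haar_measure_def by simp
  interpret A: subgroup A G by (rule A)
  have "c \<otimes> a \<notin> A" if "a \<in> A" for a
  proof
    assume "c \<otimes> a \<in> A"
    then have "c \<otimes> a \<otimes> inv a \<in> A"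
      using that by blast
    then show False
      using c cH that by (simp add: m_assoc)
  qed
  then have disj: "A \<inter> ?cA = {}"
    by blast
  show ?thesis
  \<comment> \<open>A translate outside the sigma-algebra has measure \<open>0\<close> by convention, and then so has \<open>A\<close>.\<close>
  proof (cases "?cA \<in> sets \<mu>")
    case True
    then have "emeasure \<mu> A + emeasure \<mu> ?cA = emeasure \<mu> (A \<union> ?cA)"
      using plus_emeasure[OF A(2) _ disj] by simp
    also have "\<dots> \<le> emeasure \<mu> B"
      using B sub(1) c(1) subgroup.m_closed[OF B(1)] by (intro emeasure_mono) auto
    finally show ?thesis
      using cA by (simp add: mult_2)
  next
    case False
    then show ?thesis
      using cA by (simp add: emeasure_notin_sets)
  qed
qed

text \<open>Write \<open>f y\<close> and \<open>g y\<close> for the measures of the centralizers of \<open>y\<close> in \<open>H\<close> modulo \<open>U\<close> and modulo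
  \<open>L\<close>, so that \<open>g \<le> f\<close>, and let \<open>S\<close> be the subgroup of those \<open>y \<in> K\<close> that act trivially on \<open>M/L\<close>.

  For \<open>y\<close> outside \<open>S\<close> even \<open>2 g y \<le> f y\<close>. Indeed, since \<open>H\<close> covers \<open>M/L\<close>, some \<open>h \<in> H \<inter> M\<close> does not
  commute with \<open>y\<close> modulo \<open>L\<close>; but the commutator of \<open>h\<close> and \<open>y\<close> lies in \<open>M \<le> U\<close>. So the centralizer
  modulo \<open>L\<close> is a proper subgroup of the centralizer modulo \<open>U\<close>.

  On the other hand \<open>f\<close> is invariant under translation by \<open>k \<in> U\<close>, and \<open>k S\<close> is disjoint from \<open>S\<close>, so the
  integral of \<open>f\<close> over \<open>S\<close> is at most half of its integral over \<open>K\<close>. Integrating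
  \<open>2 g \<le> f + f 1\<^sub>S\<close> gives the factor \<open>3/4\<close>.\<close>

lemma commuting_prob_mod_step:
  assumes U: "U \<lhd> G" "openin T U" and L: "L \<lhd> G" "openin T L" and M: "M \<lhd> G" "L \<subseteq> M" "M \<subseteq> U"
    and cover: "M \<subseteq> H <#> L"
    and k: "k \<in> K \<inter> U" "\<exists>m\<in>M. m \<otimes> k \<otimes> inv m \<otimes> inv k \<notin> L"
  shows "4 * commuting_prob_mod L \<le> 3 * commuting_prob_mod U"
proof -
  interpret L: normal L G by (rule L)
  interpret M: normal M G by (rule M)
  interpret U: normal U G by (rule U)
  define S where "S = {y \<in> K. \<forall>m\<in>M. y \<otimes> m \<otimes> inv y \<otimes> inv m \<in> L}"
  define f where "f = (\<lambda>y. emeasure \<mu> (centralizer_mod G H U y))"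
  define g where "g = (\<lambda>y. emeasure \<mu> (centralizer_mod G H L y))"
  have S: "subgroup S G"
    unfolding S_def using subgroup_centralizing_mod[OF L(1) K M.subset] .
  interpret S: subgroup S G by (rule S)
  have comm_sym: "x \<otimes> y \<otimes> inv x \<otimes> inv y \<in> L \<longleftrightarrow> y \<otimes> x \<otimes> inv y \<otimes> inv x \<in> L"
    if "x \<in> carrier G" "y \<in> carrier G" for x y
    using that L.commutator_mem_iff by auto
  have SK: "S \<subseteq> K"
    by (auto simp: S_def)
  have S_sets: "S \<in> sets \<nu>"
  proof -
    have "s \<otimes> n \<in> S" if "s \<in> S" "n \<in> K \<inter> L" for s n
    proof -
      have "n \<otimes> m \<otimes> inv n \<otimes> inv m \<in> L" if "m \<in> M" for m
        using L.commutator_mem_iff[of n m] r_coset_mult_normal[OF L(1), of m n] \<open>n \<in> K \<inter> L\<close> that by auto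
      then have "n \<in> S"
        using that by (simp add: S_def)
      then show ?thesis
        using that by simp
    qed
    then show ?thesis
      using open_sets(2)[OF L, of S] SK by blast
  qed
  have kK: "k \<in> K" and kU: "k \<in> U" and kG: "k \<in> carrier G"
    using k by auto
  have kS: "k \<notin> S"
    using k(2) comm_sym kG by (auto simp: S_def)
  have pointwise: "2 * g y \<le> f y + f y * indicator S y" if y: "y \<in> K" for y
  proof -
    have cU: "centralizer_mod G H U y \<in> sets \<mu>" and cL: "centralizer_mod G H L y \<in> sets \<mu>"
      using openin_centralizer_mod U L y by auto
    have sub: "centralizer_mod G H L y \<subseteq> centralizer_mod G H U y"
      using centralizer_mod_mono M by blast
    show ?thesis
    proof (cases "y \<in> S")
      case True
      have "g y \<le> f y"
        unfolding f_def g_def by (intro emeasure_mono sub cU)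
      then have "g y + g y \<le> f y + f y"
        by (intro add_mono)
      then show ?thesis
        using True by (simp add: mult_2)
    next
      case False
      then obtain m where m: "m \<in> M" "y \<otimes> m \<otimes> inv y \<otimes> inv m \<notin> L"
        using y by (auto simp: S_def)
      obtain h l where hl: "h \<in> H" "l \<in> L" "m = h \<otimes> l"
        using cover m(1) unfolding set_mult_def by blast
      have hG: "h \<in> carrier G" and lG: "l \<in> carrier G" and yG: "y \<in> carrier G"
        using hl y by auto
      have "L #> m = L #> h"
        unfolding hl(3) using r_coset_mult_normal(1)[OF L(1) hG hl(2)] .
      then have "h \<otimes> y \<otimes> inv h \<otimes> inv y \<notin> L"
        using m commutator_mod_cong[OF L(1), of m h y y] comm_sym[of m y] hG yG by auto
      moreover have "h \<otimes> y \<otimes> inv h \<otimes> inv y \<in> U"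
      proof -
        have "h = m \<otimes> inv l"
          unfolding hl(3) using hG lG by (simp add: m_assoc)
        then have hM: "h \<in> M"
          using m(1) hl(2) M(2) by auto
        then have "h \<otimes> (y \<otimes> inv h \<otimes> inv y) \<in> M"
          using M.inv_op_closed2[OF yG, of "inv h"] by auto
        then show ?thesis
          using M(3) hG yG by (auto simp: m_assoc)
      qed
      ultimately have "centralizer_mod G H L y \<noteq> centralizer_mod G H U y"
        using hl(1) by (auto simp: centralizer_mod_def)
      then have "2 * g y \<le> f y"
        unfolding f_def g_def using sub cU cL subgroup_centralizer_mod[OF _ H yG] U L
        by (intro emeasure_proper_subgroup) auto
      then show ?thesis
        using False by simp
    qed
  qed
  have f_meas: "f \<in> borel_measurable \<nu>" and g_meas: "g \<in> borel_measurable \<nu>"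
    unfolding f_def g_def using measurable_centralizer_mod U L by auto
  let ?kS = "{y \<in> K. inv k \<otimes> y \<in> S}"
  have topK: "topological_group (G\<lparr>carrier := K\<rparr>) (subtopology T K)"
    using topological_group_subgroup[OF top K] .
  have mult_meas: "(\<lambda>y. g \<otimes> y) \<in> measurable \<nu> \<nu>" if "g \<in> K" for g
    using haar_measurable_left_mult[OF topK reg(2)] that by simp
  have kS_sets: "?kS \<in> sets \<nu>"
  proof -
    have "(\<lambda>y. inv k \<otimes> y) -` S \<inter> space \<nu> \<in> sets \<nu>"
      using measurable_sets[OF mult_meas S_sets] kK by simp
    moreover have "(\<lambda>y. inv k \<otimes> y) -` S \<inter> space \<nu> = ?kS"
      by (auto simp: space)
    ultimately show ?thesis
      by simp
  qed
  have "(\<integral>\<^sup>+ y. f y * indicator ?kS y \<partial>\<nu>) = (\<integral>\<^sup>+ y. f y * indicator ?kS y \<partial>distr \<nu> \<nu> (\<lambda>y. k \<otimes> y))"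
    using haar_distr_left_mult[OF topK \<nu>, of k] kK by simp
  also have "\<dots> = (\<integral>\<^sup>+ y. f (k \<otimes> y) * indicator ?kS (k \<otimes> y) \<partial>\<nu>)"
    using f_meas kS_sets by (intro nn_integral_distr mult_meas kK) auto
  also have "\<dots> = (\<integral>\<^sup>+ y. f y * indicator S y \<partial>\<nu>)"
  proof (rule nn_integral_cong)
    fix y assume "y \<in> space \<nu>"
    then have y: "y \<in> K" "y \<in> carrier G"
      by (auto simp: space)
    have "f (k \<otimes> y) = f y"
      unfolding f_def using r_coset_mult_normal(2)[OF U(1) y(2) kU] centralizer_mod_cong[OF U(1) H, of "k \<otimes> y" y] kG y by simp
    moreover have "inv k \<otimes> (k \<otimes> y) = y"
      using kG y by (simp flip: m_assoc)
    ultimately show "f (k \<otimes> y) * indicator ?kS (k \<otimes> y) = f y * indicator S y"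
      using kK y by (simp add: indicator_def)
  qed
  finally have shift: "(\<integral>\<^sup>+ y. f y * indicator ?kS y \<partial>\<nu>) = (\<integral>\<^sup>+ y. f y * indicator S y \<partial>\<nu>)" .
  have disj: "S \<inter> ?kS = {}"
  proof (rule ccontr)
    assume "S \<inter> ?kS \<noteq> {}"
    then obtain y where y: "y \<in> S" "inv k \<otimes> y \<in> S"
      by blast
    then have "y \<otimes> inv (inv k \<otimes> y) \<in> S"
      by blast
    moreover have "y \<otimes> inv (inv k \<otimes> y) = k"
      using y kG by (simp add: inv_mult_group flip: m_assoc)
    ultimately show False
      using kS by simp
  qed
  have "2 * (\<integral>\<^sup>+ y. f y * indicator S y \<partial>\<nu>) = (\<integral>\<^sup>+ y. f y * indicator S y + f y * indicator ?kS y \<partial>\<nu>)"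
    using f_meas S_sets kS_sets shift by (subst nn_integral_add) (auto simp: mult_2)
  also have "\<dots> \<le> (\<integral>\<^sup>+ y. f y \<partial>\<nu>)"
    using disj by (intro nn_integral_mono) (auto simp: indicator_def)
  finally have half: "2 * (\<integral>\<^sup>+ y. f y * indicator S y \<partial>\<nu>) \<le> (\<integral>\<^sup>+ y. f y \<partial>\<nu>)" .
  have "2 * (\<integral>\<^sup>+ y. g y \<partial>\<nu>) = (\<integral>\<^sup>+ y. 2 * g y \<partial>\<nu>)"
    using g_meas by (simp add: nn_integral_cmult)
  also have "\<dots> \<le> (\<integral>\<^sup>+ y. f y + f y * indicator S y \<partial>\<nu>)"
    using pointwise by (intro nn_integral_mono) (auto simp: space)
  also have "\<dots> = (\<integral>\<^sup>+ y. f y \<partial>\<nu>) + (\<integral>\<^sup>+ y. f y * indicator S y \<partial>\<nu>)"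
    using f_meas S_sets by (intro nn_integral_add) auto
  finally have "2 * (2 * (\<integral>\<^sup>+ y. g y \<partial>\<nu>)) \<le> 2 * ((\<integral>\<^sup>+ y. f y \<partial>\<nu>) + (\<integral>\<^sup>+ y. f y * indicator S y \<partial>\<nu>))"
    by (intro mult_left_mono) auto
  also have "\<dots> = 2 * (\<integral>\<^sup>+ y. f y \<partial>\<nu>) + 2 * (\<integral>\<^sup>+ y. f y * indicator S y \<partial>\<nu>)"
    by (simp add: distrib_left)
  also have "\<dots> \<le> 2 * (\<integral>\<^sup>+ y. f y \<partial>\<nu>) + (\<integral>\<^sup>+ y. f y \<partial>\<nu>)"
    using half by (intro add_left_mono)
  also have "\<dots> = 3 * (\<integral>\<^sup>+ y. f y \<partial>\<nu>)"
    using distrib_right[of "2 :: ennreal" 1] by simp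
  finally show ?thesis
    unfolding commuting_prob_mod_def f_def g_def by (simp flip: mult.assoc)
qed

text \<open>The set of pairs commuting modulo \<open>N\<close> is a finite union of open rectangles \<open>A C \<times> B C\<close>, indexed by the
  cosets \<open>C\<close> of \<open>N\<close> that meet \<open>K\<close>, and on rectangles \<open>\<rho>\<close> is given by \<open>\<mu>\<close> and \<open>\<nu>\<close>.\<close>

lemma commuting_le_commuting_prob_mod:
  assumes N: "N \<lhd> G" "openin T N" "finite (rcosets N)"
    and \<rho>: "product_measure_on (subtopology T H) (subtopology T K) \<mu> \<nu> \<rho>"
  shows "emeasure \<rho> {(x, y) \<in> H \<times> K. x \<otimes> y = y \<otimes> x} \<le> commuting_prob_mod N"
proof -
  interpret N: normal N G by (rule N)
  define I where "I = (\<lambda>y. N #> y) ` K"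
  define A where "A C = {x \<in> H. \<exists>y\<in>K. N #> y = C \<and> x \<otimes> y \<otimes> inv x \<otimes> inv y \<in> N}" for C
  define B where "B C = {y \<in> K. N #> y = C}" for C
  have reg_\<rho>: "regular_borel_prob (prod_topology (subtopology T H) (subtopology T K)) \<rho>"
    using \<rho> by (simp add: product_measure_on_def)
  have "I \<subseteq> rcosets N"
    unfolding I_def using K.subset by (auto intro: rcosetsI)
  then have fin: "finite I"
    using N(3) finite_subset by blast
  have A_eq: "A (N #> y) = centralizer_mod G H N y" if "y \<in> K" for y
    using that centralizer_mod_cong[OF N(1) H] K.mem_carrier unfolding A_def centralizer_mod_def by blast
  have A_open: "openin (subtopology T H) (A C) \<and> A C \<in> sets \<mu>" if "C \<in> I" for C
    using that openin_centralizer_mod[OF N(1,2)] K.mem_carrier A_eq by (auto simp: I_def)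
  have B_open: "openin (subtopology T K) (B C) \<and> B C \<in> sets \<nu>" for C
    by (rule open_sets(2)[OF N(1,2)]) (use r_coset_mult_normal(1)[OF N(1)] in \<open>auto simp: B_def\<close>)
  have AB_sets: "A C \<times> B C \<in> sets \<rho>" if "C \<in> I" for C
    using regular_borel_prob_sets(4)[OF reg_\<rho>] A_open[OF that] B_open by (simp add: openin_prod_Times_iff)
  have "{(x, y) \<in> H \<times> K. x \<otimes> y = y \<otimes> x} \<subseteq> (\<Union>C\<in>I. A C \<times> B C)"
  proof (clarify)
    fix x y assume xy: "x \<in> H" "y \<in> K" "x \<otimes> y = y \<otimes> x"
    then have "x \<otimes> y \<otimes> inv x \<otimes> inv y \<in> N"
      using commutator_eq_one_iff[of x y] by auto
    then have "x \<in> A (N #> y)" "y \<in> B (N #> y)" "N #> y \<in> I"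
      unfolding A_def B_def I_def using xy(1,2) by blast+
    then show "(x, y) \<in> (\<Union>C\<in>I. A C \<times> B C)"
      by blast
  qed
  then have "emeasure \<rho> {(x, y) \<in> H \<times> K. x \<otimes> y = y \<otimes> x} \<le> emeasure \<rho> (\<Union>C\<in>I. A C \<times> B C)"
    using fin AB_sets by (intro emeasure_mono) auto
  also have "\<dots> \<le> (\<Sum>C\<in>I. emeasure \<rho> (A C \<times> B C))"
    using fin AB_sets by (intro emeasure_subadditive_finite) auto
  also have "\<dots> = (\<Sum>C\<in>I. emeasure \<mu> (A C) * emeasure \<nu> (B C))"
    using \<rho> A_open B_open by (intro sum.cong) (auto simp: product_measure_on_def)
  also have "\<dots> = (\<Sum>C\<in>I. \<integral>\<^sup>+ y. emeasure \<mu> (A C) * indicator (B C) y \<partial>\<nu>)"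
    using B_open by (simp add: nn_integral_cmult_indicator)
  also have "\<dots> = (\<integral>\<^sup>+ y. (\<Sum>C\<in>I. emeasure \<mu> (A C) * indicator (B C) y) \<partial>\<nu>)"
    by (intro nn_integral_sum[symmetric] borel_measurable_times_ennreal borel_measurable_const
        borel_measurable_indicator) (use B_open in blast)
  also have "\<dots> = commuting_prob_mod N"
    unfolding commuting_prob_mod_def
  proof (rule nn_integral_cong)
    fix y assume "y \<in> space \<nu>"
    then have y: "y \<in> K"
      by (simp add: space)
    have "(\<Sum>C\<in>I. emeasure \<mu> (A C) * indicator (B C) y) = (\<Sum>C\<in>I. if C = N #> y then emeasure \<mu> (A C) else 0)"
      using y by (intro sum.cong) (auto simp: B_def indicator_def)
    also have "\<dots> = emeasure \<mu> (centralizer_mod G H N y)"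
      using fin y A_eq by (simp add: I_def)
    finally show "(\<Sum>C\<in>I. emeasure \<mu> (A C) * indicator (B C) y) = emeasure \<mu> (centralizer_mod G H N y)" .
  qed
  finally show ?thesis .
qed

end

section \<open>Coordinates of an inverse limit of finite groups\<close>

lemma product_topology_cong:
  assumes "\<And>i. i \<in> I \<Longrightarrow> X i = Y i"
  shows "product_topology X I = product_topology Y I"
proof -
  have "{i \<in> I. U i \<noteq> topspace (X i)} = {i \<in> I. U i \<noteq> topspace (Y i)}" for U
    using assms by auto
  then show ?thesis
    unfolding topology_eq openin_product_topology_alt using assms by simp
qed

locale profinite_presentation =
  fixes G :: "('a, 'm) monoid_scheme" (structure) and T :: "'a topology"
    and I :: "'a set set" and r and F :: "'a set \<Rightarrow> 'a set monoid" and \<phi> and h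
  assumes top: "topological_group G T"
    and sys: "inverse_system I r F \<phi>"
    and fin: "\<And>i. i \<in> I \<Longrightarrow> finite (carrier (F i))"
    and h_iso: "h \<in> iso G (inverse_limit_group I r F \<phi>)"
    and h_homeo: "homeomorphic_map T (inverse_limit_topology I r F \<phi>) h"
begin

sublocale group G
  using top by (simp add: topological_group_def)

lemma topspace_eq: "topspace T = carrier G"
  using top by (simp add: topological_group_def)

lemma sysD:
  "I \<noteq> {}"
  "\<And>i j. i \<in> I \<Longrightarrow> j \<in> I \<Longrightarrow> \<exists>k\<in>I. (i, k) \<in> r \<and> (j, k) \<in> r"
  "\<And>i. i \<in> I \<Longrightarrow> group (F i)"
  "\<And>i j. i \<in> I \<Longrightarrow> j \<in> I \<Longrightarrow> (i, j) \<in> r \<Longrightarrow> \<phi> i j \<in> hom (F j) (F i)"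
  "trans r"
  using sys by (simp_all add: inverse_system_def partial_order_on_def preorder_on_def)

lemma image_h: "h ` carrier G = inverse_limit_set I r F \<phi>"
  using h_iso by (simp add: iso_iff inverse_limit_group_def)

lemma inj_h: "inj_on h (carrier G)"
  using h_iso by (simp add: iso_iff)

lemma h_mem: "x \<in> carrier G \<Longrightarrow> h x \<in> inverse_limit_set I r F \<phi>"
  unfolding image_h[symmetric] by (rule imageI)

lemma h_compat:
  assumes "x \<in> carrier G" "i \<in> I" "j \<in> I" "(i, j) \<in> r"
  shows "\<phi> i j (h x j) = h x i"
  using h_mem[OF assms(1)] assms(2-4) by (simp add: inverse_limit_set_def)

lemma h_mult: "x \<in> carrier G \<Longrightarrow> y \<in> carrier G \<Longrightarrow> h (x \<otimes> y) = (\<lambda>i\<in>I. h x i \<otimes>\<^bsub>F i\<^esub> h y i)"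
  using h_iso by (simp add: iso_iff hom_def inverse_limit_group_def)

lemma h_PiE: "x \<in> carrier G \<Longrightarrow> h x \<in> (\<Pi>\<^sub>E i\<in>I. carrier (F i))"
  using h_mem by (simp add: inverse_limit_set_def)

lemma group_hom_proj:
  assumes "i \<in> I"
  shows "group_hom G (F i) (\<lambda>x. h x i)"
proof (intro group_hom.intro group_hom_axioms.intro homI)
  show "group (F i)"
    using sysD(3) assms .
  show "h x i \<in> carrier (F i)" if "x \<in> carrier G" for x
    using PiE_mem[OF h_PiE[OF that] assms] .
  show "h (x \<otimes> y) i = h x i \<otimes>\<^bsub>F i\<^esub> h y i" if "x \<in> carrier G" "y \<in> carrier G" for x y
    using h_mult[OF that] assms by simp
qed (rule is_group)

lemma openin_vimage_proj:
  assumes "i \<in> I"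
  shows "openin T {x \<in> carrier G. h x i \<in> S}"
proof -
  interpret p: group_hom G "F i" "\<lambda>x. h x i"
    by (rule group_hom_proj[OF assms])
  have "continuous_map T (product_topology (\<lambda>i. discrete_topology (carrier (F i))) I) h"
    using homeomorphic_imp_continuous_map[OF h_homeo]
    by (simp add: inverse_limit_topology_def continuous_map_in_subtopology)
  from continuous_map_compose[OF this continuous_map_product_projection[OF assms]]
  have "continuous_map T (discrete_topology (carrier (F i))) (\<lambda>x. h x i)"
    by (simp add: o_def)
  then have "openin T {x \<in> topspace T. h x i \<in> S \<inter> carrier (F i)}"
    by (rule openin_continuous_map_preimage) simp
  moreover have "{x \<in> topspace T. h x i \<in> S \<inter> carrier (F i)} = {x \<in> carrier G. h x i \<in> S}"
    using p.hom_closed by (auto simp: topspace_eq)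
  ultimately show ?thesis
    by simp
qed

lemma upper_bound:
  assumes "finite J" "J \<subseteq> I"
  shows "\<exists>k\<in>I. \<forall>j\<in>J. (j, k) \<in> r"
  using assms
proof (induction J rule: finite_induct)
  case empty
  then show ?case
    using sysD(1) by blast
next
  case (insert i J)
  then obtain k where k: "k \<in> I" "\<forall>j\<in>J. (j, k) \<in> r"
    by blast
  obtain l where l: "l \<in> I" "(i, l) \<in> r" "(k, l) \<in> r"
    using sysD(2)[of i k] insert.prems k(1) by blast
  have "(j, l) \<in> r" if "j \<in> J" for j
    using transD[OF sysD(5)] k(2) l(3) that by blast
  then show ?case
    using l by blast
qed

text \<open>A basic open set of the product restricts finitely many coordinates only, and since the system is
  directed all of them are determined by a single further coordinate.\<close>

lemma neighbourhood_basis: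
  assumes W: "openin T W" and x: "x \<in> W"
  shows "\<exists>i\<in>I. \<forall>y\<in>carrier G. h y i = h x i \<longrightarrow> y \<in> W"
proof -
  let ?X = "\<lambda>i. discrete_topology (carrier (F i))"
  have xG: "x \<in> carrier G"
    using openin_subset[OF W] x topspace_eq by blast
  have "openin (inverse_limit_topology I r F \<phi>) (h ` W)"
    using homeomorphic_map_openness_eq[OF h_homeo] W by blast
  then have "\<exists>O'. openin (product_topology ?X I) O' \<and> h ` W = O' \<inter> inverse_limit_set I r F \<phi>"
    by (simp only: inverse_limit_topology_def openin_subtopology)
  then obtain O' where O': "openin (product_topology ?X I) O'" "h ` W = O' \<inter> inverse_limit_set I r F \<phi>"
    by (elim exE conjE)
  have "h x \<in> O'"
    using O'(2) x by blast
  from bspec[OF O'(1)[unfolded openin_product_topology_alt] this]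
  obtain V where V: "finite {i \<in> I. V i \<noteq> topspace (?X i)}" "h x \<in> Pi\<^sub>E I V" "Pi\<^sub>E I V \<subseteq> O'"
    by (elim exE conjE)
  define J where "J = {i \<in> I. V i \<noteq> topspace (?X i)}"
  obtain k where k: "k \<in> I" "\<forall>j\<in>J. (j, k) \<in> r"
    using upper_bound[of J] V(1) by (auto simp: J_def)
  have "y \<in> W" if y: "y \<in> carrier G" "h y k = h x k" for y
  proof -
    have "h y j \<in> V j" if j: "j \<in> I" for j
    proof (cases "j \<in> J")
      case True
      then have "h y j = h x j"
        using h_compat[OF y(1) j k(1)] h_compat[OF xG j k(1)] k(2) y(2) by simp
      then show ?thesis
        using V(2) j by auto
    next
      case False
      then show ?thesis
        using h_PiE[OF y(1)] j by (auto simp: J_def)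
    qed
    then have "h y \<in> Pi\<^sub>E I V"
      using h_PiE[OF y(1)] by (auto simp: PiE_iff)
    then have "h y \<in> h ` W"
      using V(3) O'(2) image_h y(1) by blast
    then obtain w where w: "w \<in> W" "h y = h w"
      by blast
    have "w \<in> carrier G"
      using openin_subset[OF W] w(1) topspace_eq by blast
    then have "y = w"
      using inj_onD[OF inj_h w(2) y(1)] by simp
    then show ?thesis
      using w by simp
  qed
  then show ?thesis
    using k(1) by blast
qed

text \<open>The coset \<open>x U\<close> is a neighbourhood of \<open>x\<close>, so for some \<open>i\<close> it contains every element with the same
  \<open>i\<close>-th coordinate as \<open>x\<close>. By assumption one of these elements lies in \<open>U\<close>, whence \<open>x U = U\<close>.\<close>

lemma mem_open_subgroup_if_proj_mem:
  assumes U: "subgroup U G" "openin T U" and x: "x \<in> carrier G"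
    and proj: "\<And>i. i \<in> I \<Longrightarrow> h x i \<in> (\<lambda>u. h u i) ` U"
  shows "x \<in> U"
proof -
  interpret U: subgroup U G by (rule U)
  let ?W = "{y \<in> topspace T. inv x \<otimes> y \<in> U}"
  have "openin T ?W"
    using openin_continuous_map_preimage[OF topological_group_left_mult[OF top] U(2)] x by simp
  moreover have "x \<in> ?W"
    using x topspace_eq by simp
  ultimately obtain i where i: "i \<in> I" "\<forall>y\<in>carrier G. h y i = h x i \<longrightarrow> y \<in> ?W"
    using neighbourhood_basis by blast
  obtain u where u: "u \<in> U" "h x i = h u i"
    using proj[OF i(1)] by blast
  then have "inv x \<otimes> u \<in> U"
    using i(2) by (metis (mono_tags, lifting) U.mem_carrier mem_Collect_eq)
  then have "u \<otimes> inv (inv x \<otimes> u) \<in> U"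
    using u(1) by blast
  moreover have "u \<otimes> inv (inv x \<otimes> u) = x"
    using x u(1) by (simp add: inv_mult_group flip: m_assoc)
  ultimately show ?thesis
    by simp
qed

text \<open>The subgroup \<open>U\<close> is the inverse limit, over the same index set, of its images in the groups \<open>F i\<close>:
  an element of that limit comes from some \<open>x \<in> G\<close>, all of whose coordinates are coordinates of
  elements of the open subgroup \<open>U\<close>.\<close>

lemma inverse_limit_of_finite_open_subgroup:
  assumes U: "subgroup U G" "openin T U"
    and P: "\<And>i. i \<in> I \<Longrightarrow> P ((F i)\<lparr>carrier := (\<lambda>u. h u i) ` U\<rparr>)"
  shows "inverse_limit_of_finite P (G\<lparr>carrier := U\<rparr>) (subtopology T U)"
proof -
  interpret U: subgroup U G by (rule U)
  define F' where "F' i = (F i)\<lparr>carrier := (\<lambda>u. h u i) ` U\<rparr>" for i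
  have carrier_F': "carrier (F' i) = (\<lambda>u. h u i) ` U" for i
    by (simp add: F'_def)
  have sub: "subgroup ((\<lambda>u. h u i) ` U) (F i)" if "i \<in> I" for i
    using group_hom.subgroup_img_is_subgroup[OF group_hom_proj[OF that] U(1)] .
  have F'_le: "carrier (F' i) \<subseteq> carrier (F i)" if "i \<in> I" for i
    using subgroup.subset[OF sub[OF that]] by (simp add: F'_def)
  have "group (F' i)" if "i \<in> I" for i
    unfolding F'_def using group.subgroup_imp_group[OF sysD(3) sub] that by blast
  moreover have "\<phi> i j \<in> hom (F' j) (F' i)" if ij: "i \<in> I" "j \<in> I" "(i, j) \<in> r" for i j
  proof (rule homI)
    have hom: "\<phi> i j \<in> hom (F j) (F i)"
      using sysD(4) ij by blast
    show "\<phi> i j x \<in> carrier (F' i)" if "x \<in> carrier (F' j)" for x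
      using that h_compat[OF _ ij] by (auto simp: carrier_F')
    show "\<phi> i j (x \<otimes>\<^bsub>F' j\<^esub> y) = \<phi> i j x \<otimes>\<^bsub>F' i\<^esub> \<phi> i j y" if "x \<in> carrier (F' j)" "y \<in> carrier (F' j)" for x y
      using hom_mult[OF hom] that F'_le[OF ij(2)] by (auto simp: F'_def)
  qed
  ultimately have sys': "inverse_system I r F' \<phi>"
    using sys F'_le unfolding inverse_system_def by (simp add: subset_iff)
  have lim_iff: "z \<in> inverse_limit_set I r F' \<phi> \<longleftrightarrow>
      z \<in> inverse_limit_set I r F \<phi> \<and> z \<in> (\<Pi>\<^sub>E i\<in>I. carrier (F' i))" for z
    using F'_le unfolding inverse_limit_set_def PiE_iff by blast
  have lim_le: "inverse_limit_set I r F' \<phi> \<subseteq> inverse_limit_set I r F \<phi>"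
      "inverse_limit_set I r F' \<phi> \<subseteq> (\<Pi>\<^sub>E i\<in>I. carrier (F' i))"
    by (rule subsetI, drule iffD1[OF lim_iff], erule conjunct1)
      (rule subsetI, drule iffD1[OF lim_iff], erule conjunct2)
  have image_U: "inverse_limit_set I r F' \<phi> = h ` U"
  proof
    show "inverse_limit_set I r F' \<phi> \<subseteq> h ` U"
    proof
      fix z assume z: "z \<in> inverse_limit_set I r F' \<phi>"
      then obtain x where x: "x \<in> carrier G" "z = h x"
        using subsetD[OF lim_le(1) z] unfolding image_h[symmetric] by (elim imageE)
      have hx: "h x \<in> (\<Pi>\<^sub>E i\<in>I. carrier (F' i))"
        using subsetD[OF lim_le(2) z] unfolding x(2) .
      have "h x i \<in> (\<lambda>u. h u i) ` U" if "i \<in> I" for i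
        using PiE_mem[OF hx that] unfolding carrier_F' .
      then have "x \<in> U"
        by (rule mem_open_subgroup_if_proj_mem[OF U x(1)])
      then show "z \<in> h ` U"
        using x by blast
    qed
    show "h ` U \<subseteq> inverse_limit_set I r F' \<phi>"
    proof
      fix z assume "z \<in> h ` U"
      then obtain u where u: "u \<in> U" "z = h u"
        by blast
      then have "z \<in> inverse_limit_set I r F \<phi>"
        using h_mem by simp
      moreover have "z \<in> (\<Pi>\<^sub>E i\<in>I. carrier (F' i))"
        using h_PiE[of u] u by (auto simp: carrier_F' PiE_iff)
      ultimately show "z \<in> inverse_limit_set I r F' \<phi>"
        by (intro iffD2[OF lim_iff] conjI)
    qed
  qed
  have "h \<in> iso (G\<lparr>carrier := U\<rparr>) (inverse_limit_group I r F' \<phi>)"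
    unfolding iso_iff
  proof (intro conjI homI)
    show "h ` carrier (G\<lparr>carrier := U\<rparr>) = carrier (inverse_limit_group I r F' \<phi>)"
      by (simp add: inverse_limit_group_def image_U)
    show "inj_on h (carrier (G\<lparr>carrier := U\<rparr>))"
      using inj_h U.subset inj_on_subset by simp blast
    show "h x \<in> carrier (inverse_limit_group I r F' \<phi>)" if "x \<in> carrier (G\<lparr>carrier := U\<rparr>)" for x
      using that by (simp add: inverse_limit_group_def image_U)
    show "h (x \<otimes>\<^bsub>G\<lparr>carrier := U\<rparr>\<^esub> y) = h x \<otimes>\<^bsub>inverse_limit_group I r F' \<phi>\<^esub> h y"
      if "x \<in> carrier (G\<lparr>carrier := U\<rparr>)" "y \<in> carrier (G\<lparr>carrier := U\<rparr>)" for x y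
      using h_mult[of x y] that by (simp add: inverse_limit_group_def F'_def)
  qed
  moreover have "homeomorphic_map (subtopology T U) (inverse_limit_topology I r F' \<phi>) h"
  proof -
    have "inverse_limit_topology I r F' \<phi> =
        subtopology (product_topology (\<lambda>i. subtopology (discrete_topology (carrier (F i))) (carrier (F' i))) I)
          (inverse_limit_set I r F' \<phi>)"
      unfolding inverse_limit_topology_def
      using F'_le by (intro arg_cong2[of _ _ _ _ subtopology] product_topology_cong refl)
        (simp add: subtopology_discrete_topology Int_absorb1)
    also have "\<dots> = subtopology (product_topology (\<lambda>i. discrete_topology (carrier (F i))) I)
          ((\<Pi>\<^sub>E i\<in>I. carrier (F' i)) \<inter> inverse_limit_set I r F' \<phi>)"
      by (simp only: subtopology_subtopology flip: subtopology_product_topology)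
    also have "(\<Pi>\<^sub>E i\<in>I. carrier (F' i)) \<inter> inverse_limit_set I r F' \<phi> = inverse_limit_set I r F \<phi> \<inter> h ` U"
      unfolding image_U[symmetric] Int_absorb1[OF lim_le(1)] Int_absorb1[OF lim_le(2)] ..
    also have "subtopology (product_topology (\<lambda>i. discrete_topology (carrier (F i))) I) \<dots> =
        subtopology (inverse_limit_topology I r F \<phi>) (h ` U)"
      by (simp add: inverse_limit_topology_def subtopology_subtopology)
    finally have eq: "inverse_limit_topology I r F' \<phi> = subtopology (inverse_limit_topology I r F \<phi>) (h ` U)" .
    have "h ` (topspace T \<inter> U) = topspace (inverse_limit_topology I r F \<phi>) \<inter> h ` U"
      using homeomorphic_imp_surjective_map[OF h_homeo] U.subset topspace_eq by auto
    then show ?thesis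
      unfolding eq by (rule homeomorphic_map_subtopologies[OF h_homeo])
  qed
  moreover have "\<forall>i\<in>I. finite (carrier (F' i)) \<and> P (F' i)"
    using finite_subset[OF F'_le fin] P by (simp add: F'_def)
  ultimately show ?thesis
    unfolding inverse_limit_of_finite_def using topological_group_subgroup[OF top U(1)] sys' by blast
qed

text \<open>The image of \<open>U\<close> in some \<open>F i\<close> is not nilpotent, and the kernel of some \<open>j\<close>-th coordinate lies in \<open>U\<close>.
  Both properties pass on to an index \<open>k\<close> above \<open>i\<close> and \<open>j\<close>, where the finite theory applies to the
  image \<open>Q\<close> of \<open>G\<close> in \<open>F k\<close>.\<close>

lemma exists_eccentric_section:
  assumes sol: "\<And>i. i \<in> I \<Longrightarrow> solvable (F i)" and U: "U \<lhd> G" "openin T U"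
    and not_pronil: "\<not> pronilpotent (G\<lparr>carrier := U\<rparr>) (subtopology T U)"
  shows "\<exists>L M p q. eccentric_section G U L M p q \<and> openin T L \<and> finite (rcosets L)"
proof -
  interpret U: normal U G by (rule U)
  obtain i where i: "i \<in> I" and not_nil: "\<not> nilpotent ((F i)\<lparr>carrier := (\<lambda>u. h u i) ` U\<rparr>)"
    using inverse_limit_of_finite_open_subgroup[OF U.subgroup_axioms U(2), of nilpotent] not_pronil
    unfolding pronilpotent_def by blast
  obtain j where j: "j \<in> I" "\<forall>y\<in>carrier G. h y j = h \<one> j \<longrightarrow> y \<in> U"
    using neighbourhood_basis[OF U(2) U.one_closed] by blast
  obtain k where k: "k \<in> I" "(i, k) \<in> r" "(j, k) \<in> r"
    using sysD(2)[OF i j(1)] by blast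
  interpret pk: group_hom G "F k" "\<lambda>x. h x k"
    by (rule group_hom_proj[OF k(1)])
  define Q where "Q = (F k)\<lparr>carrier := (\<lambda>x. h x k) ` carrier G\<rparr>"
  have subQ: "subgroup ((\<lambda>x. h x k) ` carrier G) (F k)"
    using pk.img_is_subgroup .
  interpret q: group_hom G Q "\<lambda>x. h x k"
    unfolding Q_def using pk.induced_group_hom[OF subgroup_self] by simp
  have surj: "(\<lambda>x. h x k) ` carrier G = carrier Q"
    by (simp add: Q_def)
  have finQ: "finite (carrier Q)"
    unfolding Q_def using fin[OF k(1)] subgroup.subset[OF subQ] by (simp add: finite_subset)
  have "group_hom Q (F k) (\<lambda>x. x)"
    using q.H.group_axioms pk.H.group_axioms subgroup.subset[OF subQ]
    by (intro group_hom.intro group_hom_axioms.intro homI) (auto simp: Q_def)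
  then have solQ: "solvable Q"
    by (rule group_hom.inj_hom_imp_solvable) (use sol[OF k(1)] in auto)
  have ker: "kernel G Q (\<lambda>x. h x k) \<subseteq> U"
  proof
    fix y assume "y \<in> kernel G Q (\<lambda>x. h x k)"
    then have y: "y \<in> carrier G" "h y k = h \<one> k"
      unfolding kernel_def q.hom_one by simp_all
    then have "h y j = h \<one> j"
      using h_compat[OF y(1) j(1) k(1,3)] h_compat[OF one_closed j(1) k(1,3)] by (simp only:)
    then show "y \<in> U"
      using j(2) y(1) by blast
  qed
  have not_nil_Q: "\<not> nilpotent (Q\<lparr>carrier := (\<lambda>x. h x k) ` U\<rparr>)"
  proof
    assume nil: "nilpotent (Q\<lparr>carrier := (\<lambda>x. h x k) ` U\<rparr>)"
    have sub: "subgroup ((\<lambda>x. h x l) ` U) (F l)" if "l \<in> I" for l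
      using group_hom.subgroup_img_is_subgroup[OF group_hom_proj[OF that] U.subgroup_axioms] .
    have "group_hom (F k) (F i) (\<phi> i k)"
      using sysD(3,4) i k by (intro group_hom.intro group_hom_axioms.intro) auto
    from group_hom.induced_group_hom[OF this sub[OF k(1)]]
    have hom: "group_hom ((F k)\<lparr>carrier := (\<lambda>x. h x k) ` U\<rparr>) ((F i)\<lparr>carrier := \<phi> i k ` (\<lambda>x. h x k) ` U\<rparr>) (\<phi> i k)" .
    have img: "\<phi> i k ` (\<lambda>x. h x k) ` U = (\<lambda>x. h x i) ` U"
      unfolding image_image using h_compat[OF U.mem_carrier i k(1,2)] by (intro image_cong refl)
    have "nilpotent ((F k)\<lparr>carrier := (\<lambda>x. h x k) ` U\<rparr>)"
      using nil unfolding Q_def by simp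
    then have "nilpotent ((F i)\<lparr>carrier := (\<lambda>x. h x i) ` U\<rparr>)"
      by (rule group_hom.nilpotent_img[OF hom[unfolded img], rotated]) (simp add: img)
    then show False
      using not_nil by contradiction
  qed
  obtain L M p q where LM: "kernel G Q (\<lambda>x. h x k) \<subseteq> L" "eccentric_section G U L M p q"
    using q.not_nilpotent_imp_eccentric_section[OF surj finQ solQ U(1) ker not_nil_Q] by blast
  interpret L: normal L G
    using LM(2) by (simp add: eccentric_section_def)
  have mem_L: "x \<otimes> inv y \<in> L" if "x \<in> carrier G" "y \<in> carrier G" "h x k = h y k" for x y
  proof -
    have "x \<otimes> inv y \<in> kernel G Q (\<lambda>x. h x k)"
      unfolding kernel_def
    proof (intro CollectI conjI)
      show "x \<otimes> inv y \<in> carrier G"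
        using that by simp
      have "h (x \<otimes> inv y) k = h y k \<otimes>\<^bsub>Q\<^esub> inv\<^bsub>Q\<^esub> (h y k)"
        using that(1,2) by (simp only: q.hom_mult q.hom_inv inv_closed that(3))
      then show "h (x \<otimes> inv y) k = \<one>\<^bsub>Q\<^esub>"
        using q.H.r_inv[OF q.hom_closed[OF that(2)]] by (simp only:)
    qed
    then show ?thesis
      using LM(1) by blast
  qed
  have coset_eq: "L #> x = L #> y" if "x \<in> carrier G" "y \<in> carrier G" "h x k = h y k" for x y
    using L.rcos_module_rev[OF is_group that(2,1) mem_L[OF that]] repr_independence[OF _ that(2) L.subgroup_axioms]
    by simp
  have "L = {x \<in> carrier G. h x k \<in> (\<lambda>x. h x k) ` L}"
  proof
    show "{x \<in> carrier G. h x k \<in> (\<lambda>x. h x k) ` L} \<subseteq> L"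
    proof
      fix x assume "x \<in> {x \<in> carrier G. h x k \<in> (\<lambda>x. h x k) ` L}"
      then obtain l where l: "x \<in> carrier G" "l \<in> L" "h x k = h l k"
        by blast
      then have "x \<otimes> inv l \<otimes> l \<in> L"
        using L.m_closed[OF mem_L[OF l(1) L.mem_carrier[OF l(2)] l(3)] l(2)] by simp
      then show "x \<in> L"
        using l by (simp add: m_assoc)
    qed
  qed (use L.subset in blast)
  then have "openin T L"
    using openin_vimage_proj[OF k(1), of "(\<lambda>x. h x k) ` L"] by simp
  moreover have "finite (rcosets L)"
  proof -
    let ?g = "\<lambda>z. L #> (SOME x. x \<in> carrier G \<and> h x k = z)"
    have "L #> x = ?g (h x k)" if "x \<in> carrier G" for x
      using someI[of "\<lambda>y. y \<in> carrier G \<and> h y k = h x k" x] that by (intro coset_eq) auto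
    then have "rcosets L \<subseteq> ?g ` carrier Q"
      unfolding RCOSETS_def surj[symmetric] by blast
    then show ?thesis
      using finQ finite_surj by blast
  qed
  ultimately show ?thesis
    using LM(2) by blast
qed

end

section \<open>Supernatural indices and Hall subgroups\<close>

lemma (in group) finite_rcosets_mono:
  assumes L: "subgroup L G" "finite (rcosets L)" and B: "subgroup B G" "L \<subseteq> B"
  shows "finite (rcosets B)"
proof -
  have "B #> x = B <#> (L #> x)" if "x \<in> carrier G" for x
  proof -
    have "B <#> L = B"
      using set_mult_subgroup_idem[OF B(1), of L] subgroup_incl[OF L(1) B] by simp
    then show ?thesis
      using setmult_rcos_assoc[OF subgroup.subset[OF B(1)] subgroup.subset[OF L(1)] that] by simp
  qed
  then have "rcosets B \<subseteq> (\<lambda>C. B <#> C) ` (rcosets L)"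
    unfolding RCOSETS_def by auto
  then show ?thesis
    using L(2) finite_surj by blast
qed

lemma (in group) card_rcosets_set_mult_pos:
  assumes A: "subgroup A G" and N: "N \<lhd> G" "finite (rcosets N)"
  shows "card (rcosets (A <#> N)) > 0"
proof -
  have AN: "subgroup (A <#> N) G"
    using mult_norm_subgroup[OF N(1) A] commut_normal[OF A N(1)] by simp
  have "N \<subseteq> A <#> N"
    using subgroup.one_closed[OF A] subgroup.subset[OF normal_imp_subgroup[OF N(1)]]
    by (force simp: set_mult_def)
  then have "finite (rcosets (A <#> N))"
    using finite_rcosets_mono[OF normal_imp_subgroup[OF N(1)] N(2) AN] by blast
  moreover have "(A <#> N) #> \<one> \<in> rcosets (A <#> N)"
    using rcosetsI[OF subgroup.subset[OF AN] one_closed] .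
  ultimately show ?thesis
    by (auto simp: card_gt_0_iff)
qed

lemma (in group) divides_profinite_indexI:
  assumes A: "subgroup A G" and N: "N \<lhd> G" "openin T N" "finite (rcosets N)"
    and p: "prime p" "p dvd card (rcosets (A <#> N))"
  shows "divides_supernatural p (profinite_index G T A)"
proof -
  have "multiplicity p (card (rcosets (A <#> N))) > 0"
    using p card_rcosets_set_mult_pos[OF A N(1,3)]
    by (metis bot_nat_0.not_eq_extremum not_dvd_imp_multiplicity_0 not_prime_unit multiplicity_eq_zero_iff)
  then have "0 < enat (multiplicity p (card (rcosets (A <#> N))))"
    by (simp add: zero_enat_def)
  also have "\<dots> \<le> profinite_index G T A p"
    unfolding profinite_index_def by (rule SUP_upper) (use N in simp)
  finally show ?thesis
    using p(1) by (simp add: divides_supernatural_def)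
qed

lemma hall_subgroup_not_dvd_index:
  assumes "group G" "hall_subgroup \<pi> A G T" "p \<in> \<pi>" "prime p"
    and "N \<lhd> G" "openin T N" "finite (rcosets\<^bsub>G\<^esub> N)"
  shows "\<not> p dvd card (rcosets\<^bsub>G\<^esub> (A <#>\<^bsub>G\<^esub> N))"
  using group.divides_profinite_indexI[OF assms(1) _ assms(5-7,4)] assms(2,3)
  unfolding hall_subgroup_def by blast

lemma (in group) rcosets_carrier_self: "rcosets (carrier G) = {carrier G}"
  using coset_join2[OF _ subgroup_self] one_closed by (auto simp: RCOSETS_def)

text \<open>Otherwise the trivial subgroup would cover \<open>M/L\<close>, so that \<open>M = L\<close> and nothing could act
  nontrivially on \<open>M/L\<close>. In the profinite setting this places \<open>p\<close> among the prime divisors of the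
  order of \<open>G\<close>.\<close>

lemma (in group) eccentric_section_prime_dvd_index:
  assumes "eccentric_section G U L M p q"
  shows "p dvd card (rcosets ({\<one>} <#> L))"
proof (rule ccontr)
  note e = assms[unfolded eccentric_section_def]
  interpret L: normal L G
    using e by blast
  assume "\<not> ?thesis"
  then have "M \<subseteq> {\<one>} <#> L"
    using e triv_subgroup by blast
  also have "\<dots> \<subseteq> L"
    by (auto simp: set_mult_def)
  finally have M_le_L: "M \<subseteq> L" .
  have "carrier G <#> L = carrier G"
    using set_mult_subgroup_idem[OF subgroup_self] L.subgroup_axioms by simp
  then have "\<not> q dvd card (rcosets (carrier G <#> L))"
    using e by (auto simp: rcosets_carrier_self)
  then obtain u m where um: "u \<in> carrier G \<inter> U" "m \<in> M" "m \<otimes> u \<otimes> inv m \<otimes> inv u \<notin> L"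
    using e subgroup_self by blast
  have "m \<in> L" "u \<in> carrier G"
    using um M_le_L by auto
  then have "m \<otimes> (u \<otimes> inv m \<otimes> inv u) \<in> L"
    using L.inv_op_closed2 by blast
  then show False
    using um(3) \<open>m \<in> L\<close> \<open>u \<in> carrier G\<close> by (simp add: m_assoc)
qed

section \<open>Pairs of primes and the main theorem\<close>

text \<open>Colour a pair \<open>i < j\<close> by \<open>1\<close> if \<open>p i = q j\<close>, otherwise by \<open>2\<close> if \<open>q i = p j\<close>, and otherwise by \<open>0\<close>.
  An infinite homogeneous set contains \<open>a < b < d\<close>. Colour \<open>1\<close> would give
  \<open>p b = q d = p a = q b\<close> and colour \<open>2\<close> would give \<open>q b = p d = q a = p b\<close>, contrary to the
  hypothesis.\<close>

lemma infinite_subset_separating_pairs: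
  fixes p q :: "nat \<Rightarrow> 'b"
  assumes "\<And>n. p n \<noteq> q n"
  shows "\<exists>S. infinite S \<and> (\<forall>i\<in>S. \<forall>j\<in>S. p i \<noteq> q j)"
proof -
  define c :: "nat set \<Rightarrow> nat" where
    "c A = (if p (Min A) = q (Max A) then 1 else if q (Min A) = p (Max A) then 2 else 0)" for A
  have "c A < 3" for A
    by (simp add: c_def)
  then have "\<exists>Y t. Y \<subseteq> UNIV \<and> infinite Y \<and> t < 3 \<and> (\<forall>x\<in>Y. \<forall>y\<in>Y. x \<noteq> y \<longrightarrow> c {x, y} = t)"
    by (intro Ramsey2[OF infinite_UNIV_nat] ballI impI)
  then obtain Y t where Y: "infinite Y" and t_ball: "\<forall>x\<in>Y. \<forall>y\<in>Y. x \<noteq> y \<longrightarrow> c {x, y} = t"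
    by (elim exE conjE)
  have t: "c {x, y} = t" if "x \<in> Y" "y \<in> Y" "x \<noteq> y" for x y
    using t_ball that by simp
  have c: "c {x, y} = (if p x = q y then 1 else if q x = p y then 2 else 0)" if "x < y" for x y
    using that by (simp add: c_def min_def max_def)
  have next_in_Y: "\<exists>n>m. n \<in> Y" for m
    using Y unfolding infinite_nat_iff_unbounded by simp
  obtain a where "a \<in> Y"
    using next_in_Y by blast
  moreover obtain b where "a < b" "b \<in> Y"
    using next_in_Y by blast
  moreover obtain d where "b < d" "d \<in> Y"
    using next_in_Y by blast
  ultimately have abd: "a \<in> Y" "b \<in> Y" "d \<in> Y" "a < b" "b < d"
    by simp_all
  have eq: "c {a, b} = t" "c {b, d} = t" "c {a, d} = t"
    using t[OF abd(1,2)] t[OF abd(2,3)] t[OF abd(1,3)] abd(4,5) by simp_all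
  note eqs = eq(1)[unfolded c[OF abd(4)]] eq(2)[unfolded c[OF abd(5)]]
    eq(3)[unfolded c[OF less_trans[OF abd(4,5)]]]
  have colour: "(if P then 1 else if Q then 2 else 0 :: nat) = 1 \<longleftrightarrow> P"
      "(if P then 1 else if Q then 2 else 0 :: nat) = 2 \<longleftrightarrow> \<not> P \<and> Q"
      "(if P then 1 else if Q then 2 else 0 :: nat) = 0 \<longleftrightarrow> \<not> P \<and> \<not> Q" for P Q
    by simp_all
  have "t \<noteq> 1"
  proof
    assume t1: "t = 1"
    show False
      using eqs[unfolded t1 colour] assms[of b] by simp
  qed
  moreover have "t \<noteq> 2"
  proof
    assume t2: "t = 2"
    show False
      using eqs[unfolded t2 colour] assms[of b] by simp
  qed
  moreover have "c {a, b} \<in> {0, 1, 2}"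
    by (simp add: c_def)
  ultimately have t0: "t = 0"
    unfolding eq by simp
  have lt: "p i \<noteq> q j \<and> q i \<noteq> p j" if "i \<in> Y" "j \<in> Y" "i < j" for i j
  proof -
    have "c {i, j} = 0"
      using t[OF that(1,2)] that(3) t0 by simp
    then show ?thesis
      unfolding c[OF that(3)] colour .
  qed
  have "p i \<noteq> q j" if "i \<in> Y" "j \<in> Y" for i j
  proof (cases i j rule: linorder_cases)
    case less
    then show ?thesis
      using lt[OF that] by simp
  next
    case equal
    then show ?thesis
      using assms[of i] by simp
  next
    case greater
    then show ?thesis
      using lt[OF that(2,1)] by metis
  qed
  then show ?thesis
    using Y by blast
qed

lemma unbounded_card_Int_lessThan:
  fixes S :: "nat set"
  assumes "infinite S"
  shows "\<exists>n. k \<le> card (S \<inter> {..<n})"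
proof -
  obtain B where B: "finite B" "card B = k" "B \<subseteq> S"
    using infinite_arbitrarily_large[OF assms] by blast
  obtain n where "\<forall>x\<in>B. x < n"
    using B(1) finite_nat_set_iff_bounded by blast
  then have "B \<subseteq> S \<inter> {..<n}"
    using B(3) by auto
  then have "card B \<le> card (S \<inter> {..<n})"
    by (intro card_mono) auto
  then show ?thesis
    using B(2) by blast
qed

text \<open>Each \<open>n \<in> S\<close> contributes a factor \<open>3/4\<close>; the other steps of the chain do not increase the commuting
  probability. Denominators are cleared because the values are extended nonnegative reals.\<close>

lemma (in haar_pair) commuting_prob_mod_chain_le:
  assumes U: "\<And>n. U n \<lhd> G" "\<And>n. openin T (U n)"
    and ecc: "\<And>n. eccentric_section G (U n) (U (Suc n)) (M n) (p n) (q n)"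
    and p: "\<And>n. n \<in> S \<Longrightarrow> \<not> p n dvd card (rcosets (H <#> U (Suc n)))"
    and q: "\<And>n. n \<in> S \<Longrightarrow> \<not> q n dvd card (rcosets (K <#> U (Suc n)))"
  shows "4 ^ card (S \<inter> {..<n}) * commuting_prob_mod (U n) \<le> 3 ^ card (S \<inter> {..<n})"
proof (induction n)
  case 0
  then show ?case
    using commuting_prob_mod_le_one by simp
next
  case (Suc n)
  note e = ecc[of n, unfolded eccentric_section_def]
  show ?case
  proof (cases "n \<in> S")
    case True
    have cover: "M n \<subseteq> H <#> U (Suc n)"
      using e H p[OF True] by blast
    obtain k m where k: "k \<in> K \<inter> U n" "m \<in> M n" "m \<otimes> k \<otimes> inv m \<otimes> inv k \<notin> U (Suc n)"
      using e K q[OF True] by blast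
    have step: "4 * commuting_prob_mod (U (Suc n)) \<le> 3 * commuting_prob_mod (U n)"
      using e k by (intro commuting_prob_mod_step[OF U U _ _ _ cover k(1)]) auto
    have S: "S \<inter> {..<Suc n} = insert n (S \<inter> {..<n})"
      using True by auto
    have "4 ^ card (S \<inter> {..<Suc n}) * commuting_prob_mod (U (Suc n)) =
        4 ^ card (S \<inter> {..<n}) * (4 * commuting_prob_mod (U (Suc n)))"
      unfolding S by (simp add: ac_simps)
    also have "\<dots> \<le> 4 ^ card (S \<inter> {..<n}) * (3 * commuting_prob_mod (U n))"
      by (intro mult_left_mono step) simp
    also have "\<dots> = 3 * (4 ^ card (S \<inter> {..<n}) * commuting_prob_mod (U n))"
      by (simp add: ac_simps)
    also have "\<dots> \<le> 3 * 3 ^ card (S \<inter> {..<n})"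
      by (intro mult_left_mono Suc) simp
    also have "\<dots> = 3 ^ card (S \<inter> {..<Suc n})"
      unfolding S by simp
    finally show ?thesis .
  next
    case False
    then have S: "S \<inter> {..<Suc n} = S \<inter> {..<n}"
      by (auto simp: less_Suc_eq)
    have "U (Suc n) \<subseteq> U n"
      using e by blast
    then have "4 ^ card (S \<inter> {..<n}) * commuting_prob_mod (U (Suc n)) \<le> 4 ^ card (S \<inter> {..<n}) * commuting_prob_mod (U n)"
      by (intro mult_left_mono commuting_prob_mod_mono U) simp_all
    then show ?thesis
      unfolding S using Suc by (rule order_trans)
  qed
qed

theorem theorem1p2:
  fixes G :: "('a, 'm) monoid_scheme" and T :: "'a topology"
  assumes "prosoluble G T"
    and "\<And>\<pi>. \<pi> \<subseteq> prime_divisors_of_order G T \<Longrightarrow>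
           \<exists>H K p. hall_subgroup \<pi> H G T \<and> hall_subgroup (prime_complement \<pi>) K G T \<and>
             has_commuting_probability G T H K p \<and> p > 0"
  shows "virtually pronilpotent G T"
proof (rule ccontr)
  assume not_virt: "\<not> virtually pronilpotent G T"
  obtain I r F \<phi> h where "profinite_presentation G T I r F \<phi> h" and sol: "\<And>i. i \<in> I \<Longrightarrow> solvable (F i)"
    using assms(1) unfolding prosoluble_def inverse_limit_of_finite_def profinite_presentation_def by blast
  then interpret profinite_presentation G T I r F \<phi> h
    by blast
  have grp: "group G"
    by (rule is_group)
  define good where "good U \<longleftrightarrow> U \<lhd> G \<and> openin T U \<and> finite (rcosets\<^bsub>G\<^esub> U)" for U
  \<comment> \<open>Each member of the chain is not pronilpotent, as \<open>G\<close> is not virtually pronilpotent, and thus yields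
    the next one.\<close>
  have step: "\<exists>L. good L \<and> (\<exists>M p q. eccentric_section G U L M p q)" if U: "good U" for U
  proof -
    have "\<not> pronilpotent (G\<lparr>carrier := U\<rparr>) (subtopology T U)"
      using not_virt U normal_imp_subgroup unfolding virtually_def good_def by blast
    then obtain L M p q where "eccentric_section G U L M p q" "openin T L" "finite (rcosets\<^bsub>G\<^esub> L)"
      using exists_eccentric_section[OF sol] U unfolding good_def by blast
    then show ?thesis
      unfolding good_def eccentric_section_def by blast
  qed
  have "good (carrier G)"
  proof -
    have "openin T (carrier G)"
      using openin_topspace[of T] topspace_eq by simp
    then show ?thesis
      unfolding good_def using normal_self rcosets_carrier_self by simp
  qed
  then obtain U where good: "\<And>n. good (U n)"
    and "\<And>n. \<exists>M p q. eccentric_section G (U n) (U (Suc n)) M p q"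
    using dependent_nat_choice[of "\<lambda>_. good" "\<lambda>_ U L. \<exists>M p q. eccentric_section G U L M p q"] step by blast
  then obtain M p q where ecc: "\<And>n. eccentric_section G (U n) (U (Suc n)) (M n) (p n) (q n)"
    by metis
  have pq: "prime (p n)" "prime (q n)" "p n \<noteq> q n" for n
    using ecc[of n] by (simp_all add: eccentric_section_def)
  obtain S where S: "infinite S" "\<And>i j. i \<in> S \<Longrightarrow> j \<in> S \<Longrightarrow> p i \<noteq> q j"
    using infinite_subset_separating_pairs[of p q] pq(3) by blast
  \<comment> \<open>For \<open>n \<in> S\<close> the prime \<open>p n\<close> belongs to \<open>\<pi>\<close> and \<open>q n\<close> does not, so \<open>H\<close> has index prime to
    \<open>p n\<close> and \<open>K\<close> has index prime to \<open>q n\<close>.\<close>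
  define \<pi> where "\<pi> = p ` S"
  have U: "U n \<lhd> G" "openin T (U n)" "finite (rcosets\<^bsub>G\<^esub> (U n))" for n
    using good[of n] by (simp_all add: good_def)
  have "p n \<in> prime_divisors_of_order G T" for n
  proof -
    have "p n dvd card (rcosets\<^bsub>G\<^esub> ({\<one>\<^bsub>G\<^esub>} <#>\<^bsub>G\<^esub> U (Suc n)))"
      using eccentric_section_prime_dvd_index[OF ecc] .
    then show ?thesis
      using divides_profinite_indexI[OF triv_subgroup U pq(1)]
      by (simp add: prime_divisors_of_order_def profinite_order_def)
  qed
  then have "\<pi> \<subseteq> prime_divisors_of_order G T"
    by (auto simp: \<pi>_def)
  from assms(2)[OF this] obtain H K c where hall_H: "hall_subgroup \<pi> H G T"
    and hall_K: "hall_subgroup (prime_complement \<pi>) K G T"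
    and comm: "has_commuting_probability G T H K c" and c: "c > 0"
    by blast
  from comm obtain \<mu> \<nu> \<rho> where \<mu>: "normalized_haar_measure (G\<lparr>carrier := H\<rparr>) (subtopology T H) \<mu>"
    and \<nu>: "normalized_haar_measure (G\<lparr>carrier := K\<rparr>) (subtopology T K) \<nu>"
    and \<rho>: "product_measure_on (subtopology T H) (subtopology T K) \<mu> \<nu> \<rho>"
    and c_eq: "c = measure \<rho> {(x, y) \<in> H \<times> K. x \<otimes>\<^bsub>G\<^esub> y = y \<otimes>\<^bsub>G\<^esub> x}"
    unfolding has_commuting_probability_def by blast
  interpret haar_pair G T H K \<mu> \<nu>
    using hall_H hall_K \<mu> \<nu> top is_group by (intro haar_pair.intro haar_pair_axioms.intro) (auto simp: hall_subgroup_def)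
  have bound: "4 ^ card (S \<inter> {..<n}) * commuting_prob_mod (U n) \<le> 3 ^ card (S \<inter> {..<n})" for n
  proof (rule commuting_prob_mod_chain_le[where M = M and p = p and q = q, OF U(1,2) ecc])
    show "\<not> p n dvd card (rcosets\<^bsub>G\<^esub> (H <#>\<^bsub>G\<^esub> U (Suc n)))" if "n \<in> S" for n
      using hall_subgroup_not_dvd_index[OF grp hall_H _ pq(1) U] that by (simp add: \<pi>_def)
    show "\<not> q n dvd card (rcosets\<^bsub>G\<^esub> (K <#>\<^bsub>G\<^esub> U (Suc n)))" if "n \<in> S" for n
    proof -
      have "q n \<notin> \<pi>"
        unfolding \<pi>_def using S(2)[OF _ that] by (metis imageE)
      then show ?thesis
        using hall_subgroup_not_dvd_index[OF grp hall_K _ pq(2) U] pq(2) by (simp add: prime_complement_def)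
    qed
  qed
  have c_le: "ennreal c \<le> commuting_prob_mod (U n)" for n
  proof -
    interpret \<rho>: prob_space \<rho>
      using \<rho> by (simp add: product_measure_on_def regular_borel_prob_def)
    show ?thesis
      using commuting_le_commuting_prob_mod[OF U \<rho>] unfolding c_eq \<rho>.emeasure_eq_measure .
  qed
  obtain k where k: "(3 / 4) ^ k < c"
    using real_arch_pow_inv[OF c, of "3 / 4"] by auto
  obtain n where n: "k \<le> card (S \<inter> {..<n})"
    using unbounded_card_Int_lessThan[OF S(1)] by blast
  define d where "d = card (S \<inter> {..<n})"
  have "ennreal (4 ^ d) = 4 ^ d"
    by (simp flip: ennreal_power)
  then have "ennreal (4 ^ d * c) = 4 ^ d * ennreal c"
    using c by (simp add: ennreal_mult)
  also have "\<dots> \<le> 4 ^ d * commuting_prob_mod (U n)"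
    by (intro mult_left_mono c_le) simp
  also have "\<dots> \<le> 3 ^ d"
    using bound[of n] by (simp add: d_def)
  also have "\<dots> = ennreal (3 ^ d)"
    by (simp flip: ennreal_power)
  finally have "4 ^ d * c \<le> 3 ^ d"
    by (simp add: ennreal_le_iff)
  then have "c \<le> (3 / 4) ^ d"
    by (simp add: power_divide field_simps)
  also have "\<dots> \<le> (3 / 4) ^ k"
    using n by (intro power_decreasing) (auto simp: d_def)
  finally show False
    using k by simp
qed

end
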